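(* Let $k$ be a field, $R=k[X_1,\dots,X_n]$ with the standard $\mathbb Z^n$-grading, and let $A$ be a monomial matrix (with finitely many rows and columns) representing a free-cofree presentation of a module $M$. Let $\operatorname{rg}$ (reduce generators) denote the column-reduction procedure described in the context. Set $A_1=\operatorname{rg}(A)$ and $\tilde A=\bigl(\operatorname{rg}(A_1^T)\bigr)^T$. Then the monomial matrix $\tilde A$ represents a free-cofree presentation of the same module $M$, and $\tilde A$ is minimal (i.e. generator-minimal and cogenerator-minimal).
   Context: The standard grading on $R=k[X_1,\dots,X_n]$ is the $\mathbb Z^n$-grading with $R=\bigoplus_{\alpha\in\mathbb N^n}kX^\alpha$; $\mathfrak m=(X_1,\dots,X_n)$. $\mathbb Z^n$ carries the componentwise partial order $\le$. All modules are $\mathbb Z^n$-graded, $(\Sigma^gM)_a=M_{a-g}$. The Matlis dual is $M^\vee=\hom_R(M,E(k))$, where $E(k)$ is the graded injective hull of $k=R/\mathfrak m$ and $\hom_R(M,N)=\bigoplus_a\operatorname{Hom}_R(\Sigma^aM,N)$ with $\operatorname{Hom}_R$ the graded degree-$0$ homomorphisms. Concretely, $R^\vee$ has a copy of $k$ in each degree of $-\mathbb N^n$ and is $0$ in all other degrees; $X^\beta$ acts from degree $a$ to degree $a+\beta$ as the identity of $k$ if $a+\beta\in-\mathbb N^n$ and as $0$ otherwise. A flat-injective presentation for $M$ is a graded degree-$0$ homomorphism $\varphi\colon F\to E$ with $F$ graded flat, $E$ graded injective and $\operatorname{Im}\varphi\cong M$; it is free-cofree if $F$ is graded free and $E$ is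 cofree, i.e. the Matlis dual of a graded free module. It is generator-minimal if $\operatorname{Ker}\varphi\subseteq\mathfrak mF$, cogenerator-minimal if $\varphi^\vee\colon E^\vee\to F^\vee$ is generator-minimal, and minimal if it is both. A monomial matrix with cogenerator degrees $(\alpha_i)_{i\in I}$ and generator degrees $(\beta_j)_{j\in J}$ in $\mathbb Z^n$ is a matrix $A=(a_{ij})$ over $k$ with $a_{ij}=0$ unless $\alpha_i\ge\beta_j$. It represents the graded homomorphism $\varphi_A\colon\bigoplus_j\Sigma^{\beta_j}R\to\bigoplus_i\Sigma^{\alpha_i}R^\vee$ of degree $0$ sending the canonical basis element $e_j$ (of degree $\beta_j$) to the element whose $i$-th component is $a_{ij}\in k=(\Sigma^{\alpha_i}R^\vee)_{\beta_j}$ if $\beta_j\le\alpha_i$, and $0$ otherwise. $A$ is called (generator-, cogenerator-) minimal if $\varphi_A$ is. The transpose $A^T$ is the monomial matrix with cogenerator degrees $(-\beta_j)_{j\in J}$ and generator degrees $(-\alpha_i)_{i\in I}$; it represents the Matlis dual $\varphi_A^\vee$. Procedure $\operatorname{rg}$: $A_j$ denotes the $j$-th column of $A$. For a matrix $B\in k^{r\times s}$ and $b\in k^r$, $L(B,b)=\{x\in k^s\mid Bx=b\}$. For $j_0\in J$, $\operatorname{trunc}(A,j_0)=(c_{ij'})_{i\in I,\,j'\in J'}$ with $J'=\{j\in J\mid\beta_j\le\beta_{j_0}\}\setminus\{j_0\}$ (where $J$ is the column index set of the matrix at hand), where column $j'$ consists of the coefficients of $X^{\beta_{j_0}-\beta_{j'}}\cdot\varphi_A(e_{j'})$,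 i.e. $c_{ij'}=a_{ij'}$ if $\beta_{j_0}\le\alpha_i$ and $c_{ij'}=0$ otherwise. On input $A$, the procedure goes through the elements $j$ of the original column index set one after the other; if $L(\operatorname{trunc}(A,j),A_j)\ne\emptyset$ for the current matrix $A$, it replaces $A$ by the monomial matrix obtained by removing the column $A_j$ (with its generator degree), otherwise it leaves $A$ unchanged. It returns the final matrix $\operatorname{rg}(A)$. *)

theory Defs
  imports
    "HOL-Algebra.Module"
    "HOL-Algebra.Ideal"
    "HOL-Library.Poly_Mapping"
    "HOL-Library.Function_Algebras"
begin

section \<open>The polynomial ring and graded modules over it\<close>

text \<open>
  The variables are indexed by a finite type \<open>'n\<close>, so a degree in \<open>Z^n\<close> is a function
  \<open>'n \<Rightarrow> int\<close>, with pointwise addition and order. An exponent vector in \<open>N^n\<close> is a function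
  \<open>'n \<Rightarrow> nat\<close>. The type \<open>poly_mapping\<close> of finitely supported functions on exponent vectors
  carries the convolution product, so it is the polynomial ring \<open>k[X_1,...,X_n]\<close>.
\<close>

type_synonym 'n deg = "'n \<Rightarrow> int"
type_synonym ('n, 'k) mpoly = "('n \<Rightarrow> nat) \<Rightarrow>\<^sub>0 'k"

definition mdeg :: "('n \<Rightarrow> nat) \<Rightarrow> 'n deg" where
  "mdeg \<mu> = (\<lambda>l. int (\<mu> l))"

definition Var :: "'n \<Rightarrow> ('n, 'k::field) mpoly" where
  "Var l = Poly_Mapping.single (\<lambda>l'. if l' = l then 1 else 0) 1"

definition poly_comp :: "'n deg \<Rightarrow> ('n, 'k::field) mpoly set" where
  "poly_comp a = {p. \<forall>\<mu>\<in>Poly_Mapping.keys p. mdeg \<mu> = a}"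

definition poly_ring :: "('n::finite, 'k::field) mpoly ring" where
  "poly_ring = \<lparr>carrier = UNIV, mult = (*), one = 1, zero = 0, add = (+)\<rparr>"

definition max_ideal :: "('n::finite, 'k::field) mpoly set" where
  "max_ideal = genideal poly_ring (range Var)"

record ('n, 'a, 'm) gmodule = "('a, 'm) module" +
  comp :: "'n deg \<Rightarrow> 'm set"

text \<open>
  As for all modules of \<open>HOL-Algebra\<close>, the fields \<open>mult\<close> and \<open>one\<close> of the record have no meaning
  for a module.
\<close>

type_synonym ('n, 'k, 'm) grmod = "('n, ('n, 'k) mpoly, 'm) gmodule"

definition graded_module :: "('n::finite, 'k::field, 'm) grmod \<Rightarrow> bool" where
  "graded_module M \<longleftrightarrow>
     module poly_ring M \<and>
     (\<forall>a. subgroup (comp M a) (add_monoid M)) \<and>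
     (\<forall>a b. \<forall>p\<in>poly_comp a. \<forall>x\<in>comp M b. p \<odot>\<^bsub>M\<^esub> x \<in> comp M (a + b)) \<and>
     (\<forall>x\<in>carrier M. \<exists>!c. (\<forall>a. c a \<in> comp M a) \<and> finite {a. c a \<noteq> \<zero>\<^bsub>M\<^esub>} \<and>
                            x = (\<Oplus>\<^bsub>M\<^esub>a\<in>{a. c a \<noteq> \<zero>\<^bsub>M\<^esub>}. c a))"

definition shift :: "'n deg \<Rightarrow> ('n, 'a, 'm) gmodule \<Rightarrow> ('n, 'a, 'm) gmodule" where
  "shift g M = M\<lparr>comp := \<lambda>a. comp M (a - g)\<rparr>"

definition graded_hom ::
  "('n::finite, 'k::field, 'x) grmod \<Rightarrow> ('n, 'k, 'y) grmod \<Rightarrow> ('x \<Rightarrow> 'y) set" where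
  "graded_hom M N =
     {f \<in> carrier M \<rightarrow>\<^sub>E carrier N.
        (\<forall>x\<in>carrier M. \<forall>y\<in>carrier M. f (x \<oplus>\<^bsub>M\<^esub> y) = f x \<oplus>\<^bsub>N\<^esub> f y) \<and>
        (\<forall>p\<in>carrier poly_ring. \<forall>x\<in>carrier M. f (p \<odot>\<^bsub>M\<^esub> x) = p \<odot>\<^bsub>N\<^esub> f x) \<and>
        (\<forall>a. f ` comp M a \<subseteq> comp N a)}"

definition graded_isomorphic ::
  "('n::finite, 'k::field, 'x) grmod \<Rightarrow> ('n, 'k, 'y) grmod \<Rightarrow> bool" where
  "graded_isomorphic M N \<longleftrightarrow>
     (\<exists>f\<in>graded_hom M N. \<exists>g\<in>graded_hom N M.
        (\<forall>x\<in>carrier M. g (f x) = x) \<and> (\<forall>y\<in>carrier N. f (g y) = y))"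

definition image_module ::
  "('n::finite, 'k::field, 'x) grmod \<Rightarrow> ('x \<Rightarrow> 'y) \<Rightarrow> ('n, 'k, 'y) grmod \<Rightarrow> ('n, 'k, 'y) grmod" where
  "image_module F \<phi> E =
     E\<lparr>carrier := \<phi> ` carrier F, comp := \<lambda>a. comp E a \<inter> \<phi> ` carrier F\<rparr>"

definition hom_kernel ::
  "('n::finite, 'k::field, 'x) grmod \<Rightarrow> ('n, 'k, 'y) grmod \<Rightarrow> ('x \<Rightarrow> 'y) \<Rightarrow> 'x set" where
  "hom_kernel F E \<phi> = {x \<in> carrier F. \<phi> x = \<zero>\<^bsub>E\<^esub>}"

text \<open>The submodule \<open>\<mm>M\<close>, i.e. the one generated by the products of elements of \<open>\<mm>\<close> and of \<open>M\<close>.\<close>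

definition max_ideal_smult :: "('n::finite, 'k::field, 'm) grmod \<Rightarrow> 'm set" where
  "max_ideal_smult M =
     \<Inter>{H. submodule H poly_ring M \<and> (\<forall>p\<in>max_ideal. \<forall>x\<in>carrier M. p \<odot>\<^bsub>M\<^esub> x \<in> H)}"

definition direct_sum ::
  "'i set \<Rightarrow> ('i \<Rightarrow> ('n, 'a, 'm) gmodule) \<Rightarrow> ('n, 'a, 'i \<Rightarrow> 'm) gmodule" where
  "direct_sum I M =
     \<lparr>carrier = {x \<in> \<Pi>\<^sub>E i\<in>I. carrier (M i). finite {i\<in>I. x i \<noteq> \<zero>\<^bsub>M i\<^esub>}},
      mult = undefined, one = undefined,
      zero = (\<lambda>i\<in>I. \<zero>\<^bsub>M i\<^esub>),
      add = (\<lambda>x y. \<lambda>i\<in>I. x i \<oplus>\<^bsub>M i\<^esub> y i),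
      smult = (\<lambda>p x. \<lambda>i\<in>I. p \<odot>\<^bsub>M i\<^esub> x i),
      comp = (\<lambda>a. {x \<in> \<Pi>\<^sub>E i\<in>I. comp (M i) a. finite {i\<in>I. x i \<noteq> \<zero>\<^bsub>M i\<^esub>}})\<rparr>"


section \<open>Free modules, Matlis duality and cofree modules\<close>

definition poly_module :: "('n::finite, 'k::field, ('n, 'k) mpoly) grmod" where
  "poly_module =
     \<lparr>carrier = UNIV, mult = undefined, one = undefined, zero = 0, add = (+),
      smult = (*), comp = poly_comp\<rparr>"

text \<open>
  The graded injective hull \<open>E(k)\<close> of \<open>k\<close>, which is also the Matlis dual \<open>R^\<or>\<close> of \<open>R\<close>: the
  canonical generator of the copy of \<open>k\<close> in degree \<open>a \<le> 0\<close> is \<open>single a 1\<close>, and \<open>X^\<mu>\<close> maps it to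
  \<open>single (mdeg \<mu> + a) 1\<close> if that degree is \<open>\<le> 0\<close>, and to \<open>0\<close> otherwise.
\<close>

definition poly_dual :: "('n::finite, 'k::field, 'n deg \<Rightarrow>\<^sub>0 'k) grmod" where
  "poly_dual =
     \<lparr>carrier = {u. \<forall>a\<in>Poly_Mapping.keys u. a \<le> 0},
      mult = undefined, one = undefined, zero = 0, add = (+),
      smult = (\<lambda>p u. \<Sum>\<mu>\<in>Poly_Mapping.keys p. \<Sum>a\<in>Poly_Mapping.keys u.
                 if mdeg \<mu> + a \<le> 0
                 then Poly_Mapping.single (mdeg \<mu> + a)
                        (Poly_Mapping.lookup p \<mu> * Poly_Mapping.lookup u a)
                 else 0),
      comp = (\<lambda>a. {u. \<forall>b\<in>Poly_Mapping.keys u. b = a \<and> b \<le> 0})\<rparr>"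

text \<open>
  The graded module of homomorphisms, i.e. the direct sum of the degree-0 homomorphisms
  \<open>\<Sigma>^a M \<rightarrow> N\<close> over all degrees \<open>a\<close>. As \<open>\<Sigma>^a M\<close> and \<open>M\<close> have the same underlying module, all of
  these are linear maps \<open>M \<rightarrow> N\<close>, and the sum is formed inside the module of these maps.
\<close>

definition hom_module ::
  "('n::finite, 'k::field, 'x) grmod \<Rightarrow> ('n, 'k, 'y) grmod \<Rightarrow> ('n, 'k, 'x \<Rightarrow> 'y) grmod" where
  "hom_module M N =
     \<lparr>carrier = {f. \<exists>D h. finite D \<and> (\<forall>a\<in>D. h a \<in> graded_hom (shift a M) N) \<and>
                          f = (\<lambda>x\<in>carrier M. \<Oplus>\<^bsub>N\<^esub>a\<in>D. h a x)},
      mult = undefined, one = undefined,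
      zero = (\<lambda>x\<in>carrier M. \<zero>\<^bsub>N\<^esub>),
      add = (\<lambda>f g. \<lambda>x\<in>carrier M. f x \<oplus>\<^bsub>N\<^esub> g x),
      smult = (\<lambda>p f. \<lambda>x\<in>carrier M. p \<odot>\<^bsub>N\<^esub> f x),
      comp = (\<lambda>a. graded_hom (shift a M) N)\<rparr>"

definition matlis_dual ::
  "('n::finite, 'k::field, 'm) grmod \<Rightarrow> ('n, 'k, 'm \<Rightarrow> 'n deg \<Rightarrow>\<^sub>0 'k) grmod" where
  "matlis_dual M = hom_module M poly_dual"

definition matlis_dual_hom ::
  "('n::finite, 'k::field, 'x) grmod \<Rightarrow> ('n, 'k, 'y) grmod \<Rightarrow> ('x \<Rightarrow> 'y) \<Rightarrow>
     ('y \<Rightarrow> 'n deg \<Rightarrow>\<^sub>0 'k) \<Rightarrow> ('x \<Rightarrow> 'n deg \<Rightarrow>\<^sub>0 'k)" where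
  "matlis_dual_hom F E \<phi> = (\<lambda>f\<in>carrier (matlis_dual E). compose (carrier F) f \<phi>)"

definition free_module ::
  "'j set \<Rightarrow> ('j \<Rightarrow> 'n deg) \<Rightarrow> ('n::finite, 'k::field, 'j \<Rightarrow> ('n, 'k) mpoly) grmod" where
  "free_module J \<beta> = direct_sum J (\<lambda>j. shift (\<beta> j) poly_module)"

text \<open>
  In the next two definitions the index set is a set of elements of the type of the module. This
  is no restriction: a homogeneous basis of the free module is in bijection with a set of elements
  of \<open>F\<close>, and with a set of elements of \<open>E\<close> through the dual basis.
\<close>

definition graded_free :: "('n::finite, 'k::field, 'm) grmod \<Rightarrow> bool" where
  "graded_free F \<longleftrightarrow> (\<exists>(J :: 'm set) \<beta>. graded_isomorphic F (free_module J \<beta>))"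

definition cofree :: "('n::finite, 'k::field, 'm) grmod \<Rightarrow> bool" where
  "cofree E \<longleftrightarrow> (\<exists>(J :: 'm set) \<beta>. graded_isomorphic E (matlis_dual (free_module J \<beta>)))"


section \<open>Free-cofree presentations and minimality\<close>

definition free_cofree_presentation ::
  "('n::finite, 'k::field, 'm) grmod \<Rightarrow>
     ('n, 'k, 'x) grmod \<Rightarrow> ('n, 'k, 'y) grmod \<Rightarrow> ('x \<Rightarrow> 'y) \<Rightarrow> bool" where
  "free_cofree_presentation M F E \<phi> \<longleftrightarrow>
     graded_module M \<and> graded_module F \<and> graded_module E \<and>
     graded_free F \<and> cofree E \<and> \<phi> \<in> graded_hom F E \<and>
     graded_isomorphic (image_module F \<phi> E) M"

definition generator_minimal ::
  "('n::finite, 'k::field, 'x) grmod \<Rightarrow> ('n, 'k, 'y) grmod \<Rightarrow> ('x \<Rightarrow> 'y) \<Rightarrow> bool" where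
  "generator_minimal F E \<phi> \<longleftrightarrow> hom_kernel F E \<phi> \<subseteq> max_ideal_smult F"

definition cogenerator_minimal ::
  "('n::finite, 'k::field, 'x) grmod \<Rightarrow> ('n, 'k, 'y) grmod \<Rightarrow> ('x \<Rightarrow> 'y) \<Rightarrow> bool" where
  "cogenerator_minimal F E \<phi> \<longleftrightarrow>
     generator_minimal (matlis_dual E) (matlis_dual F) (matlis_dual_hom F E \<phi>)"


section \<open>Monomial matrices\<close>

text \<open>
  The entries, cogenerator degrees and generator degrees outside of the index sets \<open>rows\<close> and
  \<open>cols\<close> are irrelevant.
\<close>

record ('i, 'j, 'n, 'k) monmat =
  rows :: "'i set"
  cols :: "'j set"
  cogdeg :: "'i \<Rightarrow> 'n deg"
  gendeg :: "'j \<Rightarrow> 'n deg"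
  entry :: "'i \<Rightarrow> 'j \<Rightarrow> 'k"

definition monomial_matrix :: "('i, 'j, 'n::finite, 'k::field) monmat \<Rightarrow> bool" where
  "monomial_matrix A \<longleftrightarrow>
     (\<forall>i\<in>rows A. \<forall>j\<in>cols A. \<not> gendeg A j \<le> cogdeg A i \<longrightarrow> entry A i j = 0)"

definition mat_source ::
  "('i, 'j, 'n::finite, 'k::field) monmat \<Rightarrow> ('n, 'k, 'j \<Rightarrow> ('n, 'k) mpoly) grmod" where
  "mat_source A = free_module (cols A) (gendeg A)"

definition mat_target ::
  "('i, 'j, 'n::finite, 'k::field) monmat \<Rightarrow> ('n, 'k, 'i \<Rightarrow> 'n deg \<Rightarrow>\<^sub>0 'k) grmod" where
  "mat_target A = direct_sum (rows A) (\<lambda>i. shift (cogdeg A i) poly_dual)"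

text \<open>
  The image of the basis element \<open>e_j\<close>. The degree \<open>\<beta>_j\<close> component of \<open>\<Sigma>^(\<alpha>_i) R^\<or>\<close> is the
  component of \<open>R^\<or>\<close> in degree \<open>\<beta>_j - \<alpha>_i\<close>. The homomorphism of \<open>A\<close> is the linear extension.
\<close>

definition mat_col ::
  "('i, 'j, 'n::finite, 'k::field) monmat \<Rightarrow> 'j \<Rightarrow> 'i \<Rightarrow> 'n deg \<Rightarrow>\<^sub>0 'k" where
  "mat_col A j = (\<lambda>i\<in>rows A. if gendeg A j \<le> cogdeg A i
                             then Poly_Mapping.single (gendeg A j - cogdeg A i) (entry A i j)
                             else 0)"

definition mat_hom ::
  "('i, 'j, 'n::finite, 'k::field) monmat \<Rightarrow>
     ('j \<Rightarrow> ('n, 'k) mpoly) \<Rightarrow> ('i \<Rightarrow> 'n deg \<Rightarrow>\<^sub>0 'k)" where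
  "mat_hom A = (\<lambda>x\<in>carrier (mat_source A).
     \<Oplus>\<^bsub>mat_target A\<^esub>j\<in>{j\<in>cols A. x j \<noteq> 0}. x j \<odot>\<^bsub>mat_target A\<^esub> mat_col A j)"

definition represents_presentation ::
  "('i, 'j, 'n::finite, 'k::field) monmat \<Rightarrow> ('n, 'k, 'm) grmod \<Rightarrow> bool" where
  "represents_presentation A M \<longleftrightarrow>
     free_cofree_presentation M (mat_source A) (mat_target A) (mat_hom A)"

definition mat_generator_minimal :: "('i, 'j, 'n::finite, 'k::field) monmat \<Rightarrow> bool" where
  "mat_generator_minimal A \<longleftrightarrow> generator_minimal (mat_source A) (mat_target A) (mat_hom A)"

definition mat_cogenerator_minimal :: "('i, 'j, 'n::finite, 'k::field) monmat \<Rightarrow> bool" where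
  "mat_cogenerator_minimal A \<longleftrightarrow> cogenerator_minimal (mat_source A) (mat_target A) (mat_hom A)"

definition mat_transpose ::
  "('i, 'j, 'n::finite, 'k::field) monmat \<Rightarrow> ('j, 'i, 'n, 'k) monmat" where
  "mat_transpose A =
     \<lparr>rows = cols A, cols = rows A,
      cogdeg = (\<lambda>j. - gendeg A j), gendeg = (\<lambda>i. - cogdeg A i),
      entry = (\<lambda>j i. entry A i j)\<rparr>"


section \<open>The reduction procedure\<close>

definition solutions ::
  "'i set \<Rightarrow> 'j set \<Rightarrow> ('i \<Rightarrow> 'j \<Rightarrow> 'k::field) \<Rightarrow> ('i \<Rightarrow> 'k) \<Rightarrow> ('j \<Rightarrow> 'k) set" where
  "solutions I J B b = {x \<in> J \<rightarrow>\<^sub>E UNIV. \<forall>i\<in>I. (\<Sum>j\<in>J. B i j * x j) = b i}"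

definition trunc_cols :: "('i, 'j, 'n::finite, 'k::field) monmat \<Rightarrow> 'j \<Rightarrow> 'j set" where
  "trunc_cols A j0 = {j\<in>cols A. gendeg A j \<le> gendeg A j0} - {j0}"

definition trunc :: "('i, 'j, 'n::finite, 'k::field) monmat \<Rightarrow> 'j \<Rightarrow> 'i \<Rightarrow> 'j \<Rightarrow> 'k" where
  "trunc A j0 i j = (if gendeg A j0 \<le> cogdeg A i then entry A i j else 0)"

definition rg_step ::
  "'j \<Rightarrow> ('i, 'j, 'n::finite, 'k::field) monmat \<Rightarrow> ('i, 'j, 'n, 'k) monmat" where
  "rg_step j A =
     (if solutions (rows A) (trunc_cols A j) (trunc A j) (\<lambda>i. entry A i j) \<noteq> {}
      then A\<lparr>cols := cols A - {j}\<rparr> else A)"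

text \<open>The list is the order in which the procedure goes through the columns.\<close>

definition rg ::
  "'j list \<Rightarrow> ('i, 'j, 'n::finite, 'k::field) monmat \<Rightarrow> ('i, 'j, 'n, 'k) monmat" where
  "rg js A = fold rg_step js A"

end

theory Submission
  imports Defs
begin

text \<open>
  Call a column \<open>j\<close> of a monomial matrix redundant if the linear system that the procedure tests for
  it is solvable. A solution \<open>y\<close> says exactly that the image of the basis element \<open>e_j\<close> is an
  \<open>R\<close>-linear combination of the images of the other basis elements, with the homogeneous
  coefficients \<open>y_l X^(\<beta>_j - \<beta>_l)\<close> (\<open>redundant_column_combination\<close>); the truncation takes
  care of the degrees in which multiplication by the monomial is zero on the target. The proof has
  two halves.

  The image is preserved. Removing a redundant column does not change the image of the homomorphism
  at all (\<open>mat_image_remove_col\<close>). Removing a redundant row is the transposed situation: now the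
  coordinate of that row is, on the image, a fixed combination of the other coordinates, with
  homogeneous coefficients. So forgetting the coordinate is injective on the image and has a graded
  inverse (\<open>mat_image_remove_row\<close>).

  The result is minimal. The procedure ends with a matrix without redundant columns, because
  solvability is inherited from a smaller set of columns by a larger one: a column that was kept
  when it was tested stays irredundant (\<open>rg_irredundant\<close>). The subsequent deletion of redundant
  rows creates no new redundant column, since a solution for the remaining rows also satisfies the
  equation of the deleted row (\<open>redundant_if_fewer_rows\<close>). It remains to see that a matrix without
  redundant columns is generator-minimal. If \<open>x\<close> is in the kernel and some coordinate \<open>x_j\<close> has a
  constant coefficient \<open>c \<noteq> 0\<close>, then comparing the coefficients in degree \<open>\<beta>_j\<close> and dividing by
  \<open>-c\<close> solves the system of the column \<open>j\<close> (\<open>constant_coeff_zero\<close>); hence all \<open>x_j\<close> lie in the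
  maximal ideal. For cogenerator-minimality the same argument is applied to the transpose, after
  identifying the Matlis dual of the target: each of its elements has the form
  \<open>u \<mapsto> \<Sum>i. p_i u_i\<close> with polynomials \<open>p_i\<close> (\<open>matlis_dual_eq\<close>).

  That the target is cofree rests on the pairing
  \<open>(x, u) \<mapsto> \<Sum>i. x_i u_i\<close>, which identifies a finite direct sum of shifted copies of \<open>R^\<or>\<close> with the
  Matlis dual of a free module (\<open>shifted_dual_sum_isomorphic\<close>).
\<close>


section \<open>Coefficients of polynomials and the action on the dual of the polynomial ring\<close>

text \<open>
  Coefficients are read off at degrees in \<open>Z^n\<close>, with value \<open>0\<close> outside of \<open>N^n\<close>, because all degree
  arguments below involve differences of degrees.
\<close>

definition pcoeff :: "('n, 'k::field) mpoly \<Rightarrow> 'n deg \<Rightarrow> 'k" where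
  "pcoeff p d = (if 0 \<le> d then Poly_Mapping.lookup p (\<lambda>l. nat (d l)) else 0)"

definition monom_at :: "'n deg \<Rightarrow> 'k \<Rightarrow> ('n, 'k::field) mpoly" where
  "monom_at d c = (if 0 \<le> d then Poly_Mapping.single (\<lambda>l. nat (d l)) c else 0)"

abbreviation dual_act ::
  "('n::finite, 'k::field) mpoly \<Rightarrow> ('n deg \<Rightarrow>\<^sub>0 'k) \<Rightarrow> 'n deg \<Rightarrow>\<^sub>0 'k" (infixr "\<star>" 75) where
  "p \<star> u \<equiv> p \<odot>\<^bsub>poly_dual\<^esub> u"

lemma mdeg_nonneg: "0 \<le> mdeg \<mu>"
  by (simp add: mdeg_def le_fun_def)

lemma nat_mdeg: "(\<lambda>l. nat (mdeg \<mu> l)) = \<mu>"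
  by (simp add: mdeg_def)

lemma mdeg_nat: "0 \<le> d \<Longrightarrow> mdeg (\<lambda>l. nat (d l)) = d"
  by (auto simp: mdeg_def le_fun_def)

lemma mdeg_add: "mdeg (\<mu> + \<nu>) = mdeg \<mu> + mdeg \<nu>"
  by (auto simp: mdeg_def)

lemma pcoeff_mdeg [simp]: "pcoeff p (mdeg \<mu>) = Poly_Mapping.lookup p \<mu>"
  by (simp add: pcoeff_def mdeg_nonneg nat_mdeg)

lemma pcoeff_not_nonneg: "\<not> 0 \<le> d \<Longrightarrow> pcoeff p d = 0"
  by (simp add: pcoeff_def)

lemma pcoeff_zero [simp]: "pcoeff 0 d = 0"
  by (simp add: pcoeff_def)

lemma pcoeff_add: "pcoeff (p + q) d = pcoeff p d + pcoeff q d"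
  by (simp add: pcoeff_def lookup_add)

lemma pcoeff_sum: "pcoeff (\<Sum>x\<in>S. f x) d = (\<Sum>x\<in>S. pcoeff (f x) d)"
  by (simp add: pcoeff_def lookup_sum)

lemma poly_eqI: "(\<And>d. pcoeff p d = pcoeff q d) \<Longrightarrow> p = q"
  by (metis pcoeff_mdeg poly_mapping_eqI)

lemma pcoeff_monom_at: "pcoeff (monom_at d c) e = (if 0 \<le> d \<and> e = d then c else 0)"
proof (cases "0 \<le> d \<and> 0 \<le> e")
  case True
  then have "(\<lambda>l. nat (d l)) = (\<lambda>l. nat (e l)) \<longleftrightarrow> d = e"
    by (metis mdeg_nat)
  then show ?thesis
    using True by (auto simp: pcoeff_def monom_at_def lookup_single when_def)
qed (auto simp: pcoeff_def monom_at_def)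

lemma monom_at_zero [simp]: "monom_at d 0 = 0"
  by (simp add: monom_at_def)

lemma monom_at_add: "monom_at d (b + c) = monom_at d b + monom_at d c"
  by (simp add: monom_at_def single_add)

lemma one_eq_monom_at: "(1 :: ('n, 'k::field) mpoly) = monom_at 0 1"
  by (simp add: monom_at_def zero_fun_def[symmetric])

lemma pcoeff_nonzero_iff: "pcoeff p d \<noteq> 0 \<longleftrightarrow> d \<in> mdeg ` Poly_Mapping.keys p"
  by (metis (no_types, lifting) imageE image_eqI in_keys_iff mdeg_nat pcoeff_def pcoeff_mdeg)

lemma finite_pcoeff: "finite {d. pcoeff p d \<noteq> 0}"
  unfolding pcoeff_nonzero_iff by simp

lemma poly_comp_iff: "p \<in> poly_comp a \<longleftrightarrow> (\<forall>d. pcoeff p d \<noteq> 0 \<longrightarrow> d = a)"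
  unfolding pcoeff_nonzero_iff poly_comp_def by auto

lemma poly_comp_iff_monom_at: "p \<in> poly_comp a \<longleftrightarrow> monom_at a (pcoeff p a) = p"
proof
  assume "p \<in> poly_comp a"
  then show "monom_at a (pcoeff p a) = p"
    by (intro poly_eqI) (auto simp: pcoeff_monom_at poly_comp_iff pcoeff_not_nonneg)
next
  assume "monom_at a (pcoeff p a) = p"
  then show "p \<in> poly_comp a"
    by (metis pcoeff_monom_at poly_comp_iff)
qed

lemma monom_at_in_poly_comp: "monom_at a c \<in> poly_comp a"
  by (auto simp: poly_comp_iff pcoeff_monom_at split: if_splits)

lemma poly_eq_sum_single:
  fixes p :: "'a \<Rightarrow>\<^sub>0 'b::comm_monoid_add"
  shows
  "p = (\<Sum>\<mu>\<in>Poly_Mapping.keys p. Poly_Mapping.single \<mu> (Poly_Mapping.lookup p \<mu>))"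
proof (rule poly_mapping_eqI)
  fix \<nu>
  have "(\<Sum>\<mu>\<in>Poly_Mapping.keys p. Poly_Mapping.lookup (Poly_Mapping.single \<mu> (Poly_Mapping.lookup p \<mu>)) \<nu>)
      = (\<Sum>\<mu>\<in>Poly_Mapping.keys p. if \<mu> = \<nu> then Poly_Mapping.lookup p \<nu> else 0)"
    by (intro sum.cong) (auto simp: lookup_single when_def)
  then show "Poly_Mapping.lookup p \<nu> = Poly_Mapping.lookup
      (\<Sum>\<mu>\<in>Poly_Mapping.keys p. Poly_Mapping.single \<mu> (Poly_Mapping.lookup p \<mu>)) \<nu>"
    by (simp add: lookup_sum in_keys_iff)
qed

lemma pcoeff_eq_sum_keys:
  "(\<Sum>\<mu>\<in>Poly_Mapping.keys p. if mdeg \<mu> = d then Poly_Mapping.lookup p \<mu> else 0) = pcoeff p d"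
proof (cases "0 \<le> d")
  case True
  then have "mdeg \<mu> = d \<longleftrightarrow> \<mu> = (\<lambda>l. nat (d l))" for \<mu>
    by (metis mdeg_nat nat_mdeg)
  then show ?thesis
    using True by (simp add: pcoeff_def in_keys_iff)
next
  case False
  then have "mdeg \<mu> \<noteq> d" for \<mu>
    using mdeg_nonneg by metis
  with False show ?thesis
    by (simp add: pcoeff_def)
qed

text \<open>
  Evaluating over an arbitrary finite set containing the support makes the formula usable for
  several vectors at once, as in the proof of additivity.
\<close>

lemma lookup_dual_act:
  assumes "finite S" "Poly_Mapping.keys u \<subseteq> S"
  shows "Poly_Mapping.lookup (p \<star> u) b =
    (if b \<le> 0 then \<Sum>a\<in>S. pcoeff p (b - a) * Poly_Mapping.lookup u a else 0)"
proof -
  let ?K = "Poly_Mapping.keys"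
  let ?l = "Poly_Mapping.lookup"
  have "?l (p \<star> u) b = (\<Sum>\<mu>\<in>?K p. \<Sum>a\<in>?K u. if b \<le> 0 then
      (if mdeg \<mu> = b - a then ?l p \<mu> else 0) * ?l u a else 0)"
    unfolding poly_dual_def
    by (auto simp: lookup_sum lookup_single when_def algebra_simps intro!: sum.cong)
  also have "\<dots> = (\<Sum>a\<in>?K u. \<Sum>\<mu>\<in>?K p. if b \<le> 0 then
      (if mdeg \<mu> = b - a then ?l p \<mu> else 0) * ?l u a else 0)"
    by (rule sum.swap)
  also have "\<dots> = (if b \<le> 0 then \<Sum>a\<in>?K u. pcoeff p (b - a) * ?l u a else 0)"
    by (simp add: sum_distrib_right[symmetric] pcoeff_eq_sum_keys)
  also have "(\<Sum>a\<in>?K u. pcoeff p (b - a) * ?l u a) = (\<Sum>a\<in>S. pcoeff p (b - a) * ?l u a)"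
    using assms by (intro sum.mono_neutral_left) (auto simp: in_keys_iff)
  finally show ?thesis .
qed

lemmas lookup_dual_act_keys = lookup_dual_act[OF finite_keys subset_refl]

lemma dual_act_not_nonpos: "\<not> b \<le> 0 \<Longrightarrow> Poly_Mapping.lookup (p \<star> u) b = 0"
  by (simp add: lookup_dual_act_keys)

lemma dual_act_add_left: "(p + q) \<star> u = p \<star> u + q \<star> u"
  by (rule poly_mapping_eqI)
    (simp add: lookup_dual_act_keys lookup_add pcoeff_add sum.distrib algebra_simps)

lemma dual_act_add_right: "p \<star> (u + v) = p \<star> u + p \<star> v"
proof (rule poly_mapping_eqI)
  fix b
  let ?S = "Poly_Mapping.keys u \<union> Poly_Mapping.keys v"
  have S: "finite ?S" "Poly_Mapping.keys (u + v) \<subseteq> ?S" "Poly_Mapping.keys u \<subseteq> ?S"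
    "Poly_Mapping.keys v \<subseteq> ?S"
    by (auto simp: keys_add)
  show "Poly_Mapping.lookup (p \<star> (u + v)) b = Poly_Mapping.lookup (p \<star> u + p \<star> v) b"
    by (simp add: lookup_dual_act[OF S(1,2)] lookup_dual_act[OF S(1,3)] lookup_dual_act[OF S(1,4)]
        lookup_add sum.distrib algebra_simps)
qed

lemma dual_act_zero_left [simp]: "0 \<star> u = 0"
  by (rule poly_mapping_eqI) (simp add: lookup_dual_act_keys)

lemma dual_act_zero_right [simp]: "p \<star> 0 = 0"
  by (rule poly_mapping_eqI) (simp add: lookup_dual_act_keys)

lemma dual_act_sum_left: "(\<Sum>x\<in>S. f x) \<star> u = (\<Sum>x\<in>S. f x \<star> u)"
  by (induction S rule: infinite_finite_induct) (simp_all add: dual_act_add_left)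

lemma dual_act_sum_right: "p \<star> (\<Sum>x\<in>S. f x) = (\<Sum>x\<in>S. p \<star> f x)"
  by (induction S rule: infinite_finite_induct) (simp_all add: dual_act_add_right)

lemma lookup_monom_at_dual_act:
  assumes "0 \<le> d"
  shows "Poly_Mapping.lookup (monom_at d c \<star> u) b =
    (if b \<le> 0 then c * Poly_Mapping.lookup u (b - d) else 0)"
proof -
  have "b - a = d \<longleftrightarrow> a = b - d" for a
    by (auto simp: algebra_simps)
  moreover have "(\<Sum>a\<in>Poly_Mapping.keys u. (if b - a = d then c else 0) * Poly_Mapping.lookup u a)
    = (\<Sum>a\<in>Poly_Mapping.keys u. if b - a = d then c * Poly_Mapping.lookup u a else 0)"
    by (intro sum.cong) auto
  ultimately show ?thesis
    using assms by (auto simp: lookup_dual_act_keys pcoeff_monom_at in_keys_iff)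
qed

lemma single_eq_monom_at: "Poly_Mapping.single \<mu> c = monom_at (mdeg \<mu>) c"
  by (simp add: monom_at_def mdeg_nonneg nat_mdeg)

text \<open>
  By additivity it suffices to treat monomials. The truncation to degrees \<open>\<le> 0\<close> is compatible with
  composition because \<open>b \<le> 0\<close> implies \<open>b - mdeg \<mu> \<le> 0\<close>: a product that survives both multiplications
  at once also survives each of them separately.
\<close>

lemma dual_act_mult: "(p * q) \<star> u = p \<star> (q \<star> u)"
proof -
  have mono: "(Poly_Mapping.single \<mu> c * Poly_Mapping.single \<nu> d) \<star> u =
      Poly_Mapping.single \<mu> c \<star> (Poly_Mapping.single \<nu> d \<star> u)" for \<mu> \<nu> c d
  proof (rule poly_mapping_eqI)
    fix b
    have "b - mdeg \<mu> \<le> b"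
      using mdeg_nonneg[of \<mu>] by simp
    then have "b \<le> 0 \<Longrightarrow> b - mdeg \<mu> \<le> 0"
      using order_trans by blast
    then show "Poly_Mapping.lookup ((Poly_Mapping.single \<mu> c * Poly_Mapping.single \<nu> d) \<star> u) b =
        Poly_Mapping.lookup (Poly_Mapping.single \<mu> c \<star> (Poly_Mapping.single \<nu> d \<star> u)) b"
      unfolding mult_single
      by (simp add: single_eq_monom_at lookup_monom_at_dual_act mdeg_nonneg mdeg_add
          diff_diff_eq mult.assoc)
  qed
  let ?m = "\<lambda>p \<mu>. Poly_Mapping.single \<mu> (Poly_Mapping.lookup p \<mu>)"
  have "(p * q) \<star> u = ((\<Sum>\<mu>\<in>Poly_Mapping.keys p. ?m p \<mu>) * (\<Sum>\<nu>\<in>Poly_Mapping.keys q. ?m q \<nu>)) \<star> u"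
    by (simp flip: poly_eq_sum_single)
  also have "\<dots> = (\<Sum>\<mu>\<in>Poly_Mapping.keys p. ?m p \<mu>) \<star> ((\<Sum>\<nu>\<in>Poly_Mapping.keys q. ?m q \<nu>) \<star> u)"
    by (simp add: sum_product dual_act_sum_left dual_act_sum_right mono) (rule sum.swap)
  finally show ?thesis
    by (simp flip: poly_eq_sum_single)
qed

lemma dual_act_single:
  "Poly_Mapping.lookup (p \<star> Poly_Mapping.single a c) b = (if b \<le> 0 then pcoeff p (b - a) * c else 0)"
  by (subst lookup_dual_act[of "{a}"]) auto

lemma monom_at_dual_act_single:
  "monom_at d c \<star> Poly_Mapping.single a e =
    (if 0 \<le> d \<and> d + a \<le> 0 then Poly_Mapping.single (d + a) (c * e) else 0)"
  by (rule poly_mapping_eqI)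
    (auto simp: dual_act_single pcoeff_monom_at lookup_single when_def algebra_simps)

lemma dual_carrier: "u \<in> carrier poly_dual \<longleftrightarrow> (\<forall>b. Poly_Mapping.lookup u b \<noteq> 0 \<longrightarrow> b \<le> 0)"
  by (auto simp: poly_dual_def in_keys_iff)

lemma dual_comp: "u \<in> comp poly_dual a \<longleftrightarrow>
    (\<forall>b. Poly_Mapping.lookup u b \<noteq> 0 \<longrightarrow> b = a \<and> b \<le> 0)"
  by (auto simp: poly_dual_def in_keys_iff)

lemma dual_act_in_carrier: "p \<star> u \<in> carrier poly_dual"
  unfolding dual_carrier using dual_act_not_nonpos by blast

lemma dual_act_one: "u \<in> carrier poly_dual \<Longrightarrow> 1 \<star> u = u"
  by (rule poly_mapping_eqI) (auto simp: dual_carrier one_eq_monom_at lookup_monom_at_dual_act)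

lemma dual_act_comp:
  assumes "p \<in> poly_comp a" "u \<in> comp poly_dual b"
  shows "p \<star> u \<in> comp poly_dual (a + b)"
  unfolding dual_comp
proof (intro allI impI)
  fix c
  assume nz: "Poly_Mapping.lookup (p \<star> u) c \<noteq> 0"
  then have c: "c \<le> 0"
    using dual_act_not_nonpos by blast
  then obtain e where "pcoeff p (c - e) * Poly_Mapping.lookup u e \<noteq> 0"
    using nz by (auto simp: lookup_dual_act_keys elim: sum.not_neutral_contains_not_neutral)
  then have "c - e = a" "e = b"
    using assms by (auto simp: poly_comp_iff dual_comp)
  with c show "c = a + b \<and> c \<le> 0"
    by auto
qed

section \<open>Finite direct sums of shifted copies\<close>

abbreviation shifted_sum ::
  "'i set \<Rightarrow> ('i \<Rightarrow> 'n deg) \<Rightarrow> ('n::finite, 'k::field, 'm) grmod \<Rightarrow> ('n, 'k, 'i \<Rightarrow> 'm) grmod" where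
  "shifted_sum I g N \<equiv> direct_sum I (\<lambda>i. shift (g i) N)"

lemma shift_simps [simp]:
  "carrier (shift g M) = carrier M" "add (shift g M) = add M" "zero (shift g M) = zero M"
  "smult (shift g M) = smult M" "comp (shift g M) a = comp M (a - g)"
  by (simp_all add: shift_def)

lemma direct_sum_simps [simp]:
  "add (direct_sum I M) x y = (\<lambda>i\<in>I. x i \<oplus>\<^bsub>M i\<^esub> y i)"
  "zero (direct_sum I M) = (\<lambda>i\<in>I. \<zero>\<^bsub>M i\<^esub>)"
  "smult (direct_sum I M) p x = (\<lambda>i\<in>I. p \<odot>\<^bsub>M i\<^esub> x i)"
  "finite I \<Longrightarrow> carrier (direct_sum I M) = (\<Pi>\<^sub>E i\<in>I. carrier (M i))"
  "finite I \<Longrightarrow> comp (direct_sum I M) a = (\<Pi>\<^sub>E i\<in>I. comp (M i) a)"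
  by (auto simp: direct_sum_def)

lemma poly_ring_simps [simp]:
  "carrier poly_ring = UNIV" "mult poly_ring = (*)" "one poly_ring = 1" "zero poly_ring = 0"
  "add poly_ring = (+)"
  by (simp_all add: poly_ring_def)

lemma poly_module_simps [simp]:
  "carrier poly_module = UNIV" "zero poly_module = 0" "add poly_module = (+)"
  "smult poly_module = (*)" "comp poly_module = poly_comp"
  by (simp_all add: poly_module_def)

lemma poly_dual_simps [simp]:
  "zero poly_dual = 0" "add poly_dual = (+)"
  by (simp_all add: poly_dual_def)

lemma cring_poly_ring: "cring (poly_ring :: ('n::finite, 'k::field) mpoly ring)"
proof (rule cringI)
  show "abelian_group (poly_ring :: ('n, 'k) mpoly ring)"
    by (rule abelian_groupI) (auto simp: algebra_simps intro: exI[of _ "- x" for x])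
  show "Group.comm_monoid (poly_ring :: ('n, 'k) mpoly ring)"
    by (rule comm_monoidI) (auto simp: algebra_simps)
qed (auto simp: algebra_simps)

text \<open>
  The common structure of \<open>R\<close> and \<open>R^\<or>\<close>: the addition is that of a type class, and the
  homogeneous components are cut out by additive projections. Describing the grading by projections
  makes it pass to direct sums coordinate by coordinate.
\<close>

locale concrete_graded =
  fixes N :: "('n::finite, 'k::field, 'm::ab_group_add) grmod"
    and proj :: "'n deg \<Rightarrow> 'm \<Rightarrow> 'm"
  assumes concrete_module: "module poly_ring N"
    and add_eq [simp]: "add N = (+)" and zero_eq [simp]: "zero N = 0"
    and proj_closed: "x \<in> carrier N \<Longrightarrow> proj a x \<in> carrier N"
    and comp_iff: "x \<in> comp N a \<longleftrightarrow> x \<in> carrier N \<and> proj a x = x"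
    and proj_proj: "proj a (proj b x) = (if a = b then proj a x else 0)"
    and proj_add: "proj a (x + y) = proj a x + proj a y"
    and finite_proj: "finite {a. proj a x \<noteq> 0}"
    and sum_proj: "x \<in> carrier N \<Longrightarrow> (\<Sum>a\<in>{a. proj a x \<noteq> 0}. proj a x) = x"
    and smult_comp: "p \<in> poly_comp a \<Longrightarrow> x \<in> comp N b \<Longrightarrow> p \<odot>\<^bsub>N\<^esub> x \<in> comp N (a + b)"
begin

sublocale module poly_ring N
  by (rule concrete_module)

lemma zero_mem [simp, intro]: "0 \<in> carrier N"
  using M.zero_closed by simp

lemma add_mem [simp, intro]: "x \<in> carrier N \<Longrightarrow> y \<in> carrier N \<Longrightarrow> x + y \<in> carrier N"
  using M.a_closed by simp

lemma minus_mem [simp, intro]: "x \<in> carrier N \<Longrightarrow> - x \<in> carrier N"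
  by (metis M.a_inv_closed M.l_neg add_eq eq_neg_iff_add_eq_0 minus_minus zero_eq)

lemma smult_mem [simp, intro]: "x \<in> carrier N \<Longrightarrow> p \<odot>\<^bsub>N\<^esub> x \<in> carrier N"
  using smult_closed by simp

lemma sum_mem: "(\<And>a. a \<in> A \<Longrightarrow> f a \<in> carrier N) \<Longrightarrow> sum f A \<in> carrier N"
  by (induction A rule: infinite_finite_induct) auto

lemma finsum_eq_sum: "f \<in> A \<rightarrow> carrier N \<Longrightarrow> finsum N f A = sum f A"
  by (induction A rule: infinite_finite_induct)
    (auto simp: Pi_def M.finsum_insert M.finsum_infinite)

lemma proj_zero [simp]: "proj a 0 = 0"
  using proj_add[of a 0 0] by simp

lemma proj_minus: "proj a (- x) = - proj a x"
  using proj_add[of a x "- x"] by (simp add: eq_neg_iff_add_eq_0 add.commute)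

lemma proj_sum: "proj a (sum f A) = (\<Sum>x\<in>A. proj a (f x))"
  by (induction A rule: infinite_finite_induct) (auto simp: proj_add)

lemma comp_subset: "x \<in> comp N a \<Longrightarrow> x \<in> carrier N"
  by (simp add: comp_iff)

lemma proj_comp: "x \<in> comp N a \<Longrightarrow> proj b x = (if b = a then x else 0)"
  by (metis comp_iff proj_proj)

lemma proj_in_comp: "x \<in> carrier N \<Longrightarrow> proj a x \<in> comp N a"
  by (simp add: comp_iff proj_closed proj_proj)

lemma zero_comp: "0 \<in> comp N a"
  by (simp add: comp_iff)

lemma add_comp: "x \<in> comp N a \<Longrightarrow> y \<in> comp N a \<Longrightarrow> x + y \<in> comp N a"
  by (simp add: comp_iff proj_add)

lemma minus_comp: "x \<in> comp N a \<Longrightarrow> - x \<in> comp N a"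
  by (simp add: comp_iff proj_minus)

lemma sum_comp: "(\<And>x. x \<in> A \<Longrightarrow> f x \<in> comp N a) \<Longrightarrow> sum f A \<in> comp N a"
  by (induction A rule: infinite_finite_induct) (auto intro: zero_comp add_comp)

lemma module_shifted_sum:
  assumes "finite I"
  shows "module poly_ring (shifted_sum I g N)"
proof (rule moduleI)
  show "abelian_group (shifted_sum I g N)"
  proof (rule abelian_groupI)
    fix x
    assume x: "x \<in> carrier (shifted_sum I g N)"
    have "(\<lambda>i\<in>I. - x i) \<oplus>\<^bsub>shifted_sum I g N\<^esub> x = \<zero>\<^bsub>shifted_sum I g N\<^esub>"
      by (auto intro!: restrict_ext)
    moreover have "(\<lambda>i\<in>I. - x i) \<in> carrier (shifted_sum I g N)"
      using x assms by auto
    ultimately show "\<exists>y \<in> carrier (shifted_sum I g N).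
        y \<oplus>\<^bsub>shifted_sum I g N\<^esub> x = \<zero>\<^bsub>shifted_sum I g N\<^esub>"
      by blast
  next
    fix x
    assume "x \<in> carrier (shifted_sum I g N)"
    then have "(\<lambda>i\<in>I. x i) = x"
      using assms by (simp add: PiE_restrict)
    then show "\<zero>\<^bsub>shifted_sum I g N\<^esub> \<oplus>\<^bsub>shifted_sum I g N\<^esub> x = x"
      by (simp cong: restrict_cong)
  qed (use assms in \<open>auto intro!: restrict_ext simp: add.assoc add.commute\<close>)
next
  fix x
  assume "x \<in> carrier (shifted_sum I g N)"
  then have "(\<lambda>i\<in>I. x i) = x" "\<And>i. i \<in> I \<Longrightarrow> x i \<in> carrier N"
    using assms by (auto simp: PiE_restrict)
  then show "\<one>\<^bsub>poly_ring\<^esub> \<odot>\<^bsub>shifted_sum I g N\<^esub> x = x"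
    using smult_one by (simp cong: restrict_cong)
next
  fix p x y
  assume "x \<in> carrier (shifted_sum I g N)" "y \<in> carrier (shifted_sum I g N)"
  then show "p \<odot>\<^bsub>shifted_sum I g N\<^esub> (x \<oplus>\<^bsub>shifted_sum I g N\<^esub> y) =
      p \<odot>\<^bsub>shifted_sum I g N\<^esub> x \<oplus>\<^bsub>shifted_sum I g N\<^esub> p \<odot>\<^bsub>shifted_sum I g N\<^esub> y"
    using assms smult_r_distr by (auto intro!: restrict_ext simp: PiE_iff)
next
  fix p q x
  assume x: "x \<in> carrier (shifted_sum I g N)"
  show "(p \<oplus>\<^bsub>poly_ring\<^esub> q) \<odot>\<^bsub>shifted_sum I g N\<^esub> x =
      p \<odot>\<^bsub>shifted_sum I g N\<^esub> x \<oplus>\<^bsub>shifted_sum I g N\<^esub> q \<odot>\<^bsub>shifted_sum I g N\<^esub> x"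
    using x assms smult_l_distr by (auto intro!: restrict_ext simp: PiE_iff)
  show "(p \<otimes>\<^bsub>poly_ring\<^esub> q) \<odot>\<^bsub>shifted_sum I g N\<^esub> x =
      p \<odot>\<^bsub>shifted_sum I g N\<^esub> (q \<odot>\<^bsub>shifted_sum I g N\<^esub> x)"
    using x assms smult_assoc1 by (auto intro!: restrict_ext simp: PiE_iff)
qed (use assms cring_poly_ring in auto)

lemma finsum_shifted_sum:
  assumes "finite I" "finite A" "f \<in> A \<rightarrow> carrier (shifted_sum I g N)"
  shows "finsum (shifted_sum I g N) f A = (\<lambda>i\<in>I. \<Sum>a\<in>A. f a i)"
proof -
  interpret D: module poly_ring "shifted_sum I g N"
    using assms(1) by (rule module_shifted_sum)
  show ?thesis
    using assms(2,3)
  proof (induction A rule: finite_induct)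
    case (insert a A)
    then have "f \<in> A \<rightarrow> carrier (shifted_sum I g N)" "f a \<in> carrier (shifted_sum I g N)"
      by auto
    with insert show ?case
      by (auto simp: D.finsum_insert intro!: restrict_ext)
  qed simp
qed

text \<open>
  The homogeneous components of \<open>x\<close> are obtained by projecting each coordinate. Applying the same
  projections to any other decomposition of \<open>x\<close> recovers its summands, whence uniqueness.
\<close>

lemma graded_module_shifted_sum:
  assumes fin: "finite I"
  shows "graded_module (shifted_sum I g N)"
proof -
  let ?D = "shifted_sum I g N"
  interpret D: module poly_ring ?D
    using fin by (rule module_shifted_sum)
  have sub: "subgroup (comp ?D a) (add_monoid ?D)" for a
  proof (rule D.add.subgroupI)
    show "comp ?D a \<subseteq> carrier ?D"
      using fin comp_subset by (fastforce simp: PiE_iff)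
    have "(\<lambda>i\<in>I. 0) \<in> comp ?D a"
      using fin by (auto intro: zero_comp)
    then show "comp ?D a \<noteq> {}"
      by blast
  next
    fix x
    assume x: "x \<in> comp ?D a"
    then have xc: "x \<in> carrier ?D"
      using fin comp_subset by (fastforce simp: PiE_iff)
    have "\<ominus>\<^bsub>?D\<^esub> x = (\<lambda>i\<in>I. - x i)"
      using xc fin by (intro D.minus_equality) auto
    then show "\<ominus>\<^bsub>?D\<^esub> x \<in> comp ?D a"
      using x fin by (auto intro: minus_comp)
  next
    fix x y
    assume "x \<in> comp ?D a" "y \<in> comp ?D a"
    then show "x \<oplus>\<^bsub>?D\<^esub> y \<in> comp ?D a"
      using fin by (auto intro: add_comp)
  qed
  have comp_carrier: "x \<in> comp ?D a \<Longrightarrow> x \<in> carrier ?D" for x a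
    using subgroup.subset[OF sub] by auto
  have smult: "p \<odot>\<^bsub>?D\<^esub> x \<in> comp ?D (a + b)" if "p \<in> poly_comp a" "x \<in> comp ?D b" for a b p x
    using that fin smult_comp[of p a _ "b - g i" for i] by (auto simp: PiE_iff diff_add_eq add_diff_eq)
  have decomp: "\<exists>!c. (\<forall>a. c a \<in> comp ?D a) \<and> finite {a. c a \<noteq> \<zero>\<^bsub>?D\<^esub>} \<and>
      x = (\<Oplus>\<^bsub>?D\<^esub>a\<in>{a. c a \<noteq> \<zero>\<^bsub>?D\<^esub>}. c a)" if x: "x \<in> carrier ?D" for x
  proof (rule ex1I)
    define c where "c a = (\<lambda>i\<in>I. proj (a - g i) (x i))" for a
    have xi: "x i \<in> carrier N" if "i \<in> I" for i
      using x fin that by auto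
    have cin: "c a \<in> comp ?D a" for a
      using xi fin by (auto simp: c_def intro: proj_in_comp)
    have "c a \<noteq> \<zero>\<^bsub>?D\<^esub> \<Longrightarrow> a \<in> (\<Union>i\<in>I. (+) (g i) ` {b. proj b (x i) \<noteq> 0})" for a
      by (force simp: c_def fun_eq_iff image_iff intro: exI[of _ "a - g i" for i] split: if_splits)
    then have finc: "finite {a. c a \<noteq> \<zero>\<^bsub>?D\<^esub>}"
      by (rule_tac finite_subset[of _ "\<Union>i\<in>I. (+) (g i) ` {b. proj b (x i) \<noteq> 0}"])
        (use fin finite_proj in auto)
    have "(\<Oplus>\<^bsub>?D\<^esub>a\<in>{a. c a \<noteq> \<zero>\<^bsub>?D\<^esub>}. c a) = (\<lambda>i\<in>I. \<Sum>a\<in>{a. c a \<noteq> \<zero>\<^bsub>?D\<^esub>}. c a i)"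
      using finc fin comp_carrier[OF cin] by (intro finsum_shifted_sum) auto
    also have "\<dots> = (\<lambda>i\<in>I. x i)"
    proof (rule restrict_ext)
      fix i
      assume i: "i \<in> I"
      let ?S = "{a. c a \<noteq> \<zero>\<^bsub>?D\<^esub>}"
      have "(\<Sum>a\<in>?S. c a i) = (\<Sum>a\<in>{a. proj (a - g i) (x i) \<noteq> 0}. proj (a - g i) (x i))"
        using finc i by (intro sum.mono_neutral_cong_right) (auto simp: c_def fun_eq_iff split: if_splits)
      also have "\<dots> = (\<Sum>a\<in>{a. proj a (x i) \<noteq> 0}. proj a (x i))"
        by (rule sum.reindex_bij_witness[of _ "\<lambda>a. a + g i" "\<lambda>a. a - g i"]) auto
      finally show "(\<Sum>a\<in>?S. c a i) = x i"
        using sum_proj xi i by simp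
    qed
    also have "\<dots> = x"
      using x fin by auto
    finally show "(\<forall>a. c a \<in> comp ?D a) \<and> finite {a. c a \<noteq> \<zero>\<^bsub>?D\<^esub>} \<and>
      x = (\<Oplus>\<^bsub>?D\<^esub>a\<in>{a. c a \<noteq> \<zero>\<^bsub>?D\<^esub>}. c a)"
      using cin finc by simp
    fix d
    assume d: "(\<forall>a. d a \<in> comp ?D a) \<and> finite {a. d a \<noteq> \<zero>\<^bsub>?D\<^esub>} \<and>
      x = (\<Oplus>\<^bsub>?D\<^esub>a\<in>{a. d a \<noteq> \<zero>\<^bsub>?D\<^esub>}. d a)"
    let ?S = "{a. d a \<noteq> \<zero>\<^bsub>?D\<^esub>}"
    have "x = (\<Oplus>\<^bsub>?D\<^esub>a\<in>?S. d a)"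
      using d by blast
    also have "\<dots> = (\<lambda>i\<in>I. \<Sum>a\<in>?S. d a i)"
      using d fin comp_carrier by (intro finsum_shifted_sum) blast+
    finally have xd: "x = (\<lambda>i\<in>I. \<Sum>a\<in>?S. d a i)" .
    have "d b i = c b i" for b i
    proof (cases "i \<in> I")
      case True
      have di: "d a i \<in> comp N (a - g i)" for a
        using d True fin by auto
      have "c b i = (\<Sum>a\<in>?S. proj (b - g i) (d a i))"
        using True arg_cong[OF xd, of "\<lambda>z. z i"] by (simp add: c_def proj_sum)
      also have "\<dots> = (\<Sum>a\<in>?S. if a = b then d b i else 0)"
        by (intro sum.cong) (simp_all add: proj_comp[OF di])
      also have "\<dots> = d b i"
        using d True by auto
      finally show ?thesis ..
    next
      case False
      have "d b \<in> (\<Pi>\<^sub>E i\<in>I. comp N (b - g i))"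
        using d fin by simp
      from PiE_arb[OF this False] False show ?thesis
        by (simp add: c_def)
    qed
    then show "d = c"
      by (intro ext)
  qed
  show ?thesis
    unfolding graded_module_def
  proof (intro conjI allI ballI)
    show "module poly_ring ?D"
      using fin by (rule module_shifted_sum)
  qed (fact sub, fact smult, fact decomp)
qed

end

lemma module_poly_module: "module poly_ring (poly_module :: ('n::finite, 'k::field, _) grmod)"
proof (rule moduleI[OF cring_poly_ring])
  show "abelian_group (poly_module :: ('n, 'k, _) grmod)"
    by (rule abelian_groupI) (auto simp: add.assoc add.commute intro: exI[of _ "- x" for x])
qed (simp_all add: distrib_left distrib_right mult.assoc)

lemma poly_comp_mult:
  assumes "p \<in> poly_comp a" "q \<in> poly_comp b"
  shows "p * q \<in> poly_comp (a + b)"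
  unfolding poly_comp_def
proof (clarify)
  fix \<kappa>
  assume "\<kappa> \<in> Poly_Mapping.keys (p * q)"
  then obtain \<mu> \<nu> where "\<kappa> = \<mu> + \<nu>" "\<mu> \<in> Poly_Mapping.keys p" "\<nu> \<in> Poly_Mapping.keys q"
    using keys_mult[of p q] by blast
  then show "mdeg \<kappa> = a + b"
    using assms by (simp add: poly_comp_def mdeg_add)
qed

lemma sum_monom_at: "(\<Sum>a\<in>{a. monom_at a (pcoeff p a) \<noteq> 0}. monom_at a (pcoeff p a)) = p"
proof (rule poly_eqI)
  fix d
  let ?S = "{a. pcoeff p a \<noteq> 0}"
  have "monom_at a (pcoeff p a) \<noteq> 0 \<longleftrightarrow> pcoeff p a \<noteq> 0" for a
    by (metis monom_at_zero pcoeff_monom_at pcoeff_not_nonneg pcoeff_zero)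
  then have "pcoeff (\<Sum>a\<in>{a. monom_at a (pcoeff p a) \<noteq> 0}. monom_at a (pcoeff p a)) d =
      (\<Sum>a\<in>?S. pcoeff (monom_at a (pcoeff p a)) d)"
    by (simp add: pcoeff_sum)
  also have "\<dots> = (\<Sum>a\<in>?S. if a = d then pcoeff p d else 0)"
    by (intro sum.cong refl) (simp add: pcoeff_monom_at pcoeff_not_nonneg)
  also have "\<dots> = pcoeff p d"
    using finite_pcoeff[of p] by simp
  finally show "pcoeff (\<Sum>a\<in>{a. monom_at a (pcoeff p a) \<noteq> 0}. monom_at a (pcoeff p a)) d = pcoeff p d" .
qed

interpretation poly: concrete_graded poly_module "\<lambda>a p. monom_at a (pcoeff p a)"
proof (intro concrete_graded.intro module_poly_module, goal_cases)
  case (7 x)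
  have "{a. monom_at a (pcoeff x a) \<noteq> 0} \<subseteq> {a. pcoeff x a \<noteq> 0}"
    by auto
  then show ?case
    using finite_pcoeff finite_subset by blast
next
  case 8
  show ?case
    by (rule sum_monom_at)
next
  case (5 a b x)
  show ?case
    by (cases "0 \<le> b") (simp_all add: pcoeff_monom_at pcoeff_not_nonneg)
next
  case 4
  then show ?case
    by (simp add: poly_comp_iff_monom_at)
next
  case (9 p a x b)
  then show ?case
    by (simp add: poly_comp_mult)
qed (simp_all add: pcoeff_add monom_at_add)

lemma module_poly_dual: "module poly_ring (poly_dual :: ('n::finite, 'k::field, _) grmod)"
proof (rule moduleI[OF cring_poly_ring])
  show "abelian_group (poly_dual :: ('n, 'k, _) grmod)"
  proof (rule abelian_groupI)
    fix x :: "'n deg \<Rightarrow>\<^sub>0 'k"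
    assume "x \<in> carrier poly_dual"
    then have "- x \<in> carrier poly_dual"
      by (simp add: dual_carrier)
    then show "\<exists>y\<in>carrier poly_dual. y \<oplus>\<^bsub>poly_dual\<^esub> x = \<zero>\<^bsub>poly_dual\<^esub>"
      by (intro bexI[of _ "- x"]) auto
  next
    fix x y :: "'n deg \<Rightarrow>\<^sub>0 'k"
    assume "x \<in> carrier poly_dual" "y \<in> carrier poly_dual"
    then show "x \<oplus>\<^bsub>poly_dual\<^esub> y \<in> carrier poly_dual"
      unfolding dual_carrier poly_dual_simps lookup_add by (metis add.right_neutral)
  qed (simp_all add: dual_carrier add.assoc add.commute)
qed (simp_all add: dual_act_in_carrier dual_act_add_left dual_act_add_right dual_act_mult dual_act_one)

interpretation dual: concrete_graded poly_dual "\<lambda>a u. Poly_Mapping.single a (Poly_Mapping.lookup u a)"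
proof (intro concrete_graded.intro module_poly_dual, goal_cases)
  case (3 x a)
  then show ?case
    by (auto simp: dual_carrier lookup_single when_def)
next
  case (4 x a)
  have "x \<in> comp poly_dual a \<longleftrightarrow> x \<in> carrier poly_dual \<and>
      (\<forall>b. Poly_Mapping.lookup (Poly_Mapping.single a (Poly_Mapping.lookup x a)) b = Poly_Mapping.lookup x b)"
    unfolding dual_carrier dual_comp lookup_single when_def by metis
  then show ?case
    by (metis poly_mapping_eqI)
next
  case (5 a b x)
  then show ?case
    by (auto simp: lookup_single when_def)
next
  case (6 a x y)
  then show ?case
    by (simp add: lookup_add single_add)
next
  case (7 x)
  have "{a. Poly_Mapping.single a (Poly_Mapping.lookup x a) \<noteq> 0} = Poly_Mapping.keys x"
    by (auto simp: in_keys_iff poly_mapping_eq_iff fun_eq_iff lookup_single)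
  then show ?case
    by simp
next
  case (8 x)
  have "{a. Poly_Mapping.single a (Poly_Mapping.lookup x a) \<noteq> 0} = Poly_Mapping.keys x"
    by (auto simp: in_keys_iff poly_mapping_eq_iff fun_eq_iff lookup_single)
  then show ?case
    using poly_eq_sum_single[of x] by simp
next
  case (9 p a x b)
  then show ?case
    by (rule dual_act_comp)
qed simp_all

section \<open>Graded isomorphisms\<close>

text \<open>
  The part of the axioms of a graded module that makes a map given by a formula on the carrier,
  and undefined elsewhere, a graded homomorphism. Unlike \<open>graded_module\<close> it is immediate for images
  of homomorphisms.
\<close>

definition graded_closed :: "('n::finite, 'k::field, 'm) grmod \<Rightarrow> bool" where
  "graded_closed M \<longleftrightarrow>
     (\<forall>x\<in>carrier M. \<forall>y\<in>carrier M. x \<oplus>\<^bsub>M\<^esub> y \<in> carrier M) \<and>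
     (\<forall>p. \<forall>x\<in>carrier M. p \<odot>\<^bsub>M\<^esub> x \<in> carrier M) \<and>
     (\<forall>a. comp M a \<subseteq> carrier M)"

lemma graded_module_closed: "graded_module M \<Longrightarrow> graded_closed M"
proof -
  assume M: "graded_module M"
  then interpret module poly_ring M
    by (simp add: graded_module_def)
  have "comp M a \<subseteq> carrier M" for a
    using M subgroup.subset[of "comp M a" "add_monoid M"] by (auto simp: graded_module_def)
  then show ?thesis
    by (simp add: graded_closed_def)
qed

lemma graded_closed_shift: "graded_closed M \<Longrightarrow> graded_closed (shift a M)"
  by (simp add: graded_closed_def)

lemma graded_hom_restrictI:
  assumes "graded_closed M"
    and "\<And>x. x \<in> carrier M \<Longrightarrow> f x \<in> carrier N"
    and "\<And>x y. x \<in> carrier M \<Longrightarrow> y \<in> carrier M \<Longrightarrow> f (x \<oplus>\<^bsub>M\<^esub> y) = f x \<oplus>\<^bsub>N\<^esub> f y"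
    and "\<And>p x. x \<in> carrier M \<Longrightarrow> f (p \<odot>\<^bsub>M\<^esub> x) = p \<odot>\<^bsub>N\<^esub> f x"
    and "\<And>a x. x \<in> comp M a \<Longrightarrow> f x \<in> comp N a"
  shows "(\<lambda>x\<in>carrier M. f x) \<in> graded_hom M N"
proof -
  have "x \<in> comp M a \<Longrightarrow> x \<in> carrier M" for x a
    using assms(1) by (auto simp: graded_closed_def)
  with assms show ?thesis
    by (simp add: graded_hom_def graded_closed_def image_subset_iff)
qed

lemma graded_homD:
  assumes "f \<in> graded_hom M N"
  shows "x \<in> carrier M \<Longrightarrow> f x \<in> carrier N"
    and "x \<in> carrier M \<Longrightarrow> y \<in> carrier M \<Longrightarrow> f (x \<oplus>\<^bsub>M\<^esub> y) = f x \<oplus>\<^bsub>N\<^esub> f y"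
    and "x \<in> carrier M \<Longrightarrow> f (p \<odot>\<^bsub>M\<^esub> x) = p \<odot>\<^bsub>N\<^esub> f x"
    and "x \<in> comp M a \<Longrightarrow> f x \<in> comp N a"
    and "x \<notin> carrier M \<Longrightarrow> f x = undefined"
proof -
  have f: "f \<in> carrier M \<rightarrow>\<^sub>E carrier N"
    using assms by (simp add: graded_hom_def)
  show "x \<in> carrier M \<Longrightarrow> f x \<in> carrier N"
    by (rule PiE_mem[OF f])
  show "x \<notin> carrier M \<Longrightarrow> f x = undefined"
    by (rule PiE_arb[OF f])
qed (use assms in \<open>simp_all add: graded_hom_def image_subset_iff\<close>)

text \<open>
  The inverse of a bijective homomorphism is linear, so only its behaviour on homogeneous elements
  has to be checked.
\<close>

lemma graded_isomorphicI:
  assumes f: "f \<in> graded_hom M N" and M: "graded_closed M"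
    and N: "\<And>a. comp N a \<subseteq> carrier N"
    and g: "\<And>y. y \<in> carrier N \<Longrightarrow> g y \<in> carrier M"
    and gcomp: "\<And>a y. y \<in> comp N a \<Longrightarrow> g y \<in> comp M a"
    and gf: "\<And>x. x \<in> carrier M \<Longrightarrow> g (f x) = x"
    and fg: "\<And>y. y \<in> carrier N \<Longrightarrow> f (g y) = y"
  shows "graded_isomorphic M N"
proof -
  have ga: "y \<oplus>\<^bsub>N\<^esub> z \<in> carrier N \<and> g (y \<oplus>\<^bsub>N\<^esub> z) = g y \<oplus>\<^bsub>M\<^esub> g z"
    if "y \<in> carrier N" "z \<in> carrier N" for y z
  proof -
    have "g y \<oplus>\<^bsub>M\<^esub> g z \<in> carrier M"
      using M g that by (auto simp: graded_closed_def)
    moreover have "f (g y \<oplus>\<^bsub>M\<^esub> g z) = y \<oplus>\<^bsub>N\<^esub> z"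
      using graded_homD(2)[OF f] g fg that by auto
    ultimately show ?thesis
      using gf graded_homD(1)[OF f] by metis
  qed
  have gs: "p \<odot>\<^bsub>N\<^esub> y \<in> carrier N \<and> g (p \<odot>\<^bsub>N\<^esub> y) = p \<odot>\<^bsub>M\<^esub> g y"
    if "y \<in> carrier N" for p y
  proof -
    have "p \<odot>\<^bsub>M\<^esub> g y \<in> carrier M"
      using M g that by (auto simp: graded_closed_def)
    moreover have "f (p \<odot>\<^bsub>M\<^esub> g y) = p \<odot>\<^bsub>N\<^esub> y"
      using graded_homD(3)[OF f] g fg that by auto
    ultimately show ?thesis
      using gf graded_homD(1)[OF f] by metis
  qed
  have "graded_closed N"
    using ga gs N by (auto simp: graded_closed_def)
  then have "(\<lambda>y\<in>carrier N. g y) \<in> graded_hom N M"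
    using g ga gs gcomp by (intro graded_hom_restrictI) auto
  moreover have "\<forall>x\<in>carrier M. (\<lambda>y\<in>carrier N. g y) (f x) = x"
    using gf graded_homD(1)[OF f] by simp
  moreover have "\<forall>y\<in>carrier N. f ((\<lambda>y\<in>carrier N. g y) y) = y"
    using fg by simp
  ultimately show ?thesis
    unfolding graded_isomorphic_def using f by (intro bexI conjI)
qed

lemma graded_isomorphic_trans:
  assumes "graded_isomorphic K L" "graded_isomorphic L M" "graded_closed K" "graded_closed M"
  shows "graded_isomorphic K M"
proof -
  obtain f f' where f: "f \<in> graded_hom K L" "f' \<in> graded_hom L K"
      "\<forall>x\<in>carrier K. f' (f x) = x" "\<forall>y\<in>carrier L. f (f' y) = y"
    using assms(1) unfolding graded_isomorphic_def by auto
  obtain g g' where g: "g \<in> graded_hom L M" "g' \<in> graded_hom M L"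
      "\<forall>x\<in>carrier L. g' (g x) = x" "\<forall>y\<in>carrier M. g (g' y) = y"
    using assms(2) unfolding graded_isomorphic_def by auto
  note F = graded_homD(1-4)[OF f(1)] graded_homD(1-4)[OF f(2)]
    graded_homD(1-4)[OF g(1)] graded_homD(1-4)[OF g(2)]
  show ?thesis
  proof (rule graded_isomorphicI)
    show "(\<lambda>x\<in>carrier K. g (f x)) \<in> graded_hom K M"
      using assms(3) by (intro graded_hom_restrictI) (simp_all add: F)
    show "(f' \<circ> g') y \<in> carrier K" if "y \<in> carrier M" for y
      using that by (simp add: F)
    show "(f' \<circ> g') y \<in> comp K a" if "y \<in> comp M a" for a y
      using that by (simp add: F)
    show "comp M a \<subseteq> carrier M" for a
      using assms(4) by (simp add: graded_closed_def)
    show "(f' \<circ> g') ((\<lambda>x\<in>carrier K. g (f x)) x) = x" if "x \<in> carrier K" for x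
      using that f(3) g(3) by (simp add: F)
    show "(\<lambda>x\<in>carrier K. g (f x)) ((f' \<circ> g') y) = y" if "y \<in> carrier M" for y
      using that f(4) g(4) by (simp add: F)
  qed (rule assms(3))
qed

lemma graded_closed_image:
  assumes f: "f \<in> graded_hom F E" and F: "graded_closed F"
  shows "graded_closed (image_module F f E)"
proof -
  have "f x \<oplus>\<^bsub>E\<^esub> f y \<in> f ` carrier F" if "x \<in> carrier F" "y \<in> carrier F" for x y
    using that F graded_homD(2)[OF f] by (metis graded_closed_def imageI)
  moreover have "p \<odot>\<^bsub>E\<^esub> f x \<in> f ` carrier F" if "x \<in> carrier F" for x p
    using that F graded_homD(3)[OF f] by (metis graded_closed_def imageI)
  ultimately show ?thesis
    by (auto simp: graded_closed_def image_module_def)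
qed

section \<open>Finite direct sums as free and cofree modules\<close>

definition coord_vec :: "'i set \<Rightarrow> 'i \<Rightarrow> 'm::zero \<Rightarrow> 'i \<Rightarrow> 'm" where
  "coord_vec I i v = (\<lambda>l\<in>I. if l = i then v else 0)"

context concrete_graded
begin

lemma graded_closed_shifted_sum: "finite I \<Longrightarrow> graded_closed (shifted_sum I g N)"
  by (rule graded_module_closed) (rule graded_module_shifted_sum)

lemma homogeneous_decomposition:
  assumes "finite I" "x \<in> carrier (shifted_sum I g N)"
  obtains S c where "finite S" "\<And>a. c a \<in> comp (shifted_sum I g N) a"
    "x = (\<lambda>i\<in>I. \<Sum>a\<in>S. c a i)"
proof -
  let ?D = "shifted_sum I g N"
  obtain c where c: "\<forall>a. c a \<in> comp ?D a" "finite {a. c a \<noteq> \<zero>\<^bsub>?D\<^esub>}"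
      "x = (\<Oplus>\<^bsub>?D\<^esub>a\<in>{a. c a \<noteq> \<zero>\<^bsub>?D\<^esub>}. c a)"
    using graded_module_shifted_sum[OF assms(1), of g] assms(2) unfolding graded_module_def by blast
  have "c a \<in> carrier ?D" for a
    using c(1) graded_closed_shifted_sum[OF assms(1), of g] unfolding graded_closed_def by blast
  then have "x = (\<lambda>i\<in>I. \<Sum>a\<in>{a. c a \<noteq> \<zero>\<^bsub>?D\<^esub>}. c a i)"
    using finsum_shifted_sum[OF assms(1) c(2), of c g] c(3) by simp
  then show thesis
    by (rule that[OF c(2) spec[OF c(1)]])
qed

lemma coord_vec_carrier: "finite I \<Longrightarrow> v \<in> carrier N \<Longrightarrow> coord_vec I i v \<in> carrier (shifted_sum I g N)"
  by (auto simp: coord_vec_def)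

lemma coord_vec_comp:
  "finite I \<Longrightarrow> v \<in> comp N a \<Longrightarrow> coord_vec I i v \<in> comp (shifted_sum I g N) (a + g i)"
  by (auto simp: coord_vec_def zero_comp)

lemma smult_coord_vec:
  "p \<odot>\<^bsub>shifted_sum I g N\<^esub> coord_vec I i v = coord_vec I i (p \<odot>\<^bsub>N\<^esub> v)"
  using smult_r_null[of p] by (auto simp: coord_vec_def intro!: restrict_ext)

text \<open>
  An additive map on a finite direct sum is determined by its values on the summands. This gives
  both the expansion in a basis on the free side and the reduction to one copy of \<open>R^\<or>\<close> on the
  cofree side.
\<close>

lemma additive_eq_sum_coord_vec:
  fixes f :: "('i \<Rightarrow> 'm) \<Rightarrow> 'b::ab_group_add"
  assumes I: "finite I" and x: "x \<in> carrier (shifted_sum I g N)"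
    and f: "\<And>x y. x \<in> carrier (shifted_sum I g N) \<Longrightarrow> y \<in> carrier (shifted_sum I g N) \<Longrightarrow>
      f (x \<oplus>\<^bsub>shifted_sum I g N\<^esub> y) = f x + f y"
  shows "f x = (\<Sum>i\<in>I. f (coord_vec I i (x i)))"
proof -
  let ?D = "shifted_sum I g N"
  define t where "t S = (\<lambda>i\<in>I. if i \<in> S then x i else 0)" for S
  have xi: "x i \<in> carrier N" if "i \<in> I" for i
    using x I that by auto
  have t: "t S \<in> carrier ?D" for S
    using xi I by (auto simp: t_def)
  have "f (t S) = (\<Sum>i\<in>S. f (coord_vec I i (x i)))" if "finite S" "S \<subseteq> I" for S
    using that
  proof (induction S rule: finite_induct)
    case empty
    have "t {} \<oplus>\<^bsub>?D\<^esub> t {} = t {}"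
      by (auto simp: t_def intro!: restrict_ext)
    then show ?case
      using f[OF t t, of "{}" "{}"] by simp
  next
    case (insert i S)
    have eq: "t (insert i S) = coord_vec I i (x i) \<oplus>\<^bsub>?D\<^esub> t S"
      using insert by (auto simp: t_def coord_vec_def intro!: restrict_ext)
    have "f (t (insert i S)) = f (coord_vec I i (x i)) + f (t S)"
      unfolding eq using insert xi by (intro f coord_vec_carrier I t) auto
    then show ?case
      using insert by simp
  qed
  moreover have "t I = (\<lambda>i\<in>I. x i)"
    unfolding t_def by (rule restrict_ext) simp
  then have "t I = x"
    using x I by (simp add: PiE_restrict)
  ultimately show ?thesis
    using I by force
qed

end

text \<open>
  Needed because \<open>graded_free\<close> asks for a basis indexed by elements of the module.
\<close>

lemma free_module_reindex:
  assumes I: "finite I" and h: "inj h"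
  shows "graded_isomorphic (free_module I \<beta>) (free_module (h ` I) (\<beta> \<circ> inv_into UNIV h))"
proof (rule graded_isomorphicI)
  let ?F = "free_module I \<beta>" and ?G = "free_module (h ` I) (\<beta> \<circ> inv_into UNIV h)"
  note [simp] = free_module_def
  show "graded_closed ?F"
    using poly.graded_closed_shifted_sum[OF I] by simp
  then show "(\<lambda>x\<in>carrier ?F. \<lambda>j\<in>h ` I. x (inv_into UNIV h j)) \<in> graded_hom ?F ?G"
    using I h by (intro graded_hom_restrictI) (auto intro!: restrict_ext)
  show "comp ?G a \<subseteq> carrier ?G" for a
    using I by auto
  show "(\<lambda>i\<in>I. y (h i)) \<in> carrier ?F" if "y \<in> carrier ?G" for y
    using I by auto
  show "(\<lambda>i\<in>I. y (h i)) \<in> comp ?F a" if "y \<in> comp ?G a" for y a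
    using that I h PiE_mem[of y "h ` I" "\<lambda>j. poly_comp (a - \<beta> (inv_into UNIV h j))" "h i" for i]
    by auto
  show "(\<lambda>i\<in>I. (\<lambda>x\<in>carrier ?F. \<lambda>j\<in>h ` I. x (inv_into UNIV h j)) x (h i)) = x" if "x \<in> carrier ?F" for x
  proof -
    have "(\<lambda>i\<in>I. x i) = x"
      using that I by (simp add: PiE_restrict)
    then show ?thesis
      using that h by (simp cong: restrict_cong)
  qed
  show "(\<lambda>x\<in>carrier ?F. \<lambda>j\<in>h ` I. x (inv_into UNIV h j)) (\<lambda>i\<in>I. y (h i)) = y" if "y \<in> carrier ?G" for y
  proof -
    have "(\<lambda>j\<in>h ` I. y j) = y"
      using that I by (simp add: PiE_restrict)
    moreover have "(\<lambda>j\<in>h ` I. (\<lambda>i\<in>I. y (h i)) (inv_into UNIV h j)) = (\<lambda>j\<in>h ` I. y j)"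
      using h by (intro restrict_ext) auto
    ultimately show ?thesis
      using I by simp
  qed
qed

lemma matlis_dual_simps [simp]:
  "zero (matlis_dual M) = (\<lambda>x\<in>carrier M. 0)"
  "add (matlis_dual M) f f' = (\<lambda>x\<in>carrier M. f x + f' x)"
  "smult (matlis_dual M) p f = (\<lambda>x\<in>carrier M. p \<star> f x)"
  "comp (matlis_dual M) a = graded_hom (shift a M) poly_dual"
  by (simp_all add: matlis_dual_def hom_module_def)

lemma matlis_dual_carrier:
  "f \<in> carrier (matlis_dual M) \<longleftrightarrow> (\<exists>D h. finite D \<and>
     (\<forall>a\<in>D. h a \<in> graded_hom (shift a M) poly_dual) \<and> f = (\<lambda>x\<in>carrier M. \<Sum>a\<in>D. h a x))"
proof -
  have "(\<lambda>x\<in>carrier M. \<Oplus>\<^bsub>poly_dual\<^esub>a\<in>D. h a x) = (\<lambda>x\<in>carrier M. \<Sum>a\<in>D. h a x)"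
    if "\<forall>a\<in>D. h a \<in> graded_hom (shift a M) poly_dual" for D h
  proof (intro restrict_ext dual.finsum_eq_sum Pi_I)
    fix x a
    assume "x \<in> carrier M" "a \<in> D"
    then show "h a x \<in> carrier poly_dual"
      using graded_homD(1)[of "h a" "shift a M" poly_dual x] that by simp
  qed
  then show ?thesis
    unfolding matlis_dual_def hom_module_def by (simp cong: conj_cong)
qed

lemma comp_subset_matlis_dual:
  "graded_hom (shift a M) poly_dual \<subseteq> carrier (matlis_dual M)"
proof
  fix f
  assume f: "f \<in> graded_hom (shift a M) poly_dual"
  have "f = (\<lambda>x\<in>carrier M. f x)"
    using graded_homD(5)[OF f] by auto
  then show "f \<in> carrier (matlis_dual M)"
    using f unfolding matlis_dual_carrier
    by (intro exI[of _ "{a}"] exI[of _ "\<lambda>_. f"]) auto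
qed

text \<open>
  Elements of the Matlis dual need not be homogeneous, but they are still linear maps.
\<close>

lemma matlis_dual_carrierD:
  assumes f: "f \<in> carrier (matlis_dual M)" and M: "graded_closed M"
  shows "x \<in> carrier M \<Longrightarrow> f x \<in> carrier poly_dual"
    and "x \<in> carrier M \<Longrightarrow> y \<in> carrier M \<Longrightarrow> f (x \<oplus>\<^bsub>M\<^esub> y) = f x + f y"
    and "x \<in> carrier M \<Longrightarrow> f (p \<odot>\<^bsub>M\<^esub> x) = p \<star> f x"
    and "x \<notin> carrier M \<Longrightarrow> f x = undefined"
proof -
  obtain D h where D: "finite D" "\<forall>a\<in>D. h a \<in> graded_hom (shift a M) poly_dual"
      and feq: "f = (\<lambda>x\<in>carrier M. \<Sum>a\<in>D. h a x)"
    using f unfolding matlis_dual_carrier by blast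
  have h1: "h a x \<in> carrier poly_dual" if "a \<in> D" "x \<in> carrier M" for a x
    using graded_homD(1)[OF bspec[OF D(2) that(1)], of x] that by simp
  have h2: "h a (x \<oplus>\<^bsub>M\<^esub> y) = h a x + h a y" if "a \<in> D" "x \<in> carrier M" "y \<in> carrier M" for a x y
    using graded_homD(2)[OF bspec[OF D(2) that(1)], of x y] that by simp
  have h3: "h a (p \<odot>\<^bsub>M\<^esub> x) = p \<star> h a x" if "a \<in> D" "x \<in> carrier M" for a x p
    using graded_homD(3)[OF bspec[OF D(2) that(1)], of x p] that by simp
  show "x \<in> carrier M \<Longrightarrow> f x \<in> carrier poly_dual"
    using h1 by (auto simp: feq intro: dual.sum_mem)
  show "x \<in> carrier M \<Longrightarrow> y \<in> carrier M \<Longrightarrow> f (x \<oplus>\<^bsub>M\<^esub> y) = f x + f y"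
    using M h2 by (simp add: feq graded_closed_def sum.distrib)
  show "x \<in> carrier M \<Longrightarrow> f (p \<odot>\<^bsub>M\<^esub> x) = p \<star> f x"
    using M h3 by (simp add: feq graded_closed_def dual_act_sum_right)
  show "x \<notin> carrier M \<Longrightarrow> f x = undefined"
    by (simp add: feq)
qed

text \<open>
  The isomorphism maps \<open>u\<close> to the pairing \<open>x \<mapsto> \<Sum>i. x_i u_i\<close>; its inverse evaluates a functional on
  the basis vectors. The pairing with an inhomogeneous \<open>u\<close> lies in the Matlis dual because \<open>u\<close> is a
  finite sum of homogeneous elements. The index sets are allowed to differ by an injection \<open>h\<close>
  because \<open>cofree\<close> asks for indices of the type of the module.
\<close>

lemma shifted_dual_sum_isomorphic:
  fixes \<alpha> :: "'i \<Rightarrow> 'n::finite deg" and h :: "'i \<Rightarrow> 'j"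
  assumes I: "finite I" and h: "inj h"
  shows "graded_isomorphic (shifted_sum I \<alpha> (poly_dual :: ('n, 'k::field, _) grmod))
    (matlis_dual (free_module (h ` I) (\<lambda>j. - \<alpha> (inv_into UNIV h j))))"
proof -
  define \<beta> where "\<beta> j = - \<alpha> (inv_into UNIV h j)" for j
  let ?E = "shifted_sum I \<alpha> (poly_dual :: ('n, 'k::field, _) grmod)"
  let ?F = "free_module (h ` I) \<beta> :: ('n, 'k, _) grmod"
  have F: "?F = shifted_sum (h ` I) \<beta> poly_module"
    by (simp add: free_module_def)
  have J: "finite (h ` I)"
    using I by simp
  have Fcl: "graded_closed ?F"
    unfolding F by (rule poly.graded_closed_shifted_sum[OF J])
  have Ecl: "graded_closed ?E"
    by (rule dual.graded_closed_shifted_sum[OF I])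
  have Fc: "carrier ?F = (\<Pi>\<^sub>E j\<in>h ` I. UNIV)" "comp ?F a = (\<Pi>\<^sub>E j\<in>h ` I. poly_comp (a - \<beta> j))" for a
    using J by (simp_all add: F)
  have Fops: "x \<oplus>\<^bsub>?F\<^esub> y = (\<lambda>j\<in>h ` I. x j + y j)" "p \<odot>\<^bsub>?F\<^esub> x = (\<lambda>j\<in>h ` I. p * x j)" for x y p
    by (simp_all add: F)
  define pair where "pair u = (\<lambda>x\<in>carrier ?F. \<Sum>i\<in>I. x (h i) \<star> u i)" for u :: "'i \<Rightarrow> 'n deg \<Rightarrow>\<^sub>0 'k"
  define e where "e i = coord_vec (h ` I) (h i) (1 :: ('n, 'k) mpoly)" for i
  have e: "e i \<in> carrier ?F" for i
    by (auto simp: e_def Fc coord_vec_def)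
  have pair_hom: "pair u \<in> graded_hom (shift a ?F) poly_dual" if u: "u \<in> comp ?E a" for u a
  proof -
    have "(\<lambda>x\<in>carrier (shift a ?F). \<Sum>i\<in>I. x (h i) \<star> u i) \<in> graded_hom (shift a ?F) poly_dual"
    proof (rule graded_hom_restrictI[OF graded_closed_shift[OF Fcl]])
      fix b x
      assume x: "x \<in> comp (shift a ?F) b"
      show "(\<Sum>i\<in>I. x (h i) \<star> u i) \<in> comp poly_dual b"
      proof (rule dual.sum_comp)
        fix i
        assume i: "i \<in> I"
        then have "x (h i) \<in> poly_comp (b - a + \<alpha> i)" "u i \<in> comp poly_dual (a - \<alpha> i)"
          using PiE_mem[of x "h ` I" "\<lambda>j. poly_comp (b - a - \<beta> j)" "h i"] x u h I
          by (auto simp: Fc \<beta>_def)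
        from dual_act_comp[OF this] show "x (h i) \<star> u i \<in> comp poly_dual b"
          by simp
      qed
    qed (auto simp: Fops dual_act_add_left dual_act_mult dual_act_sum_right sum.distrib
        intro: dual.sum_mem dual_act_in_carrier)
    then show ?thesis
      by (simp add: pair_def)
  qed
  have pair_carrier: "pair u \<in> carrier (matlis_dual ?F)" if u: "u \<in> carrier ?E" for u
  proof -
    obtain S c where c: "finite S" "\<And>a. c a \<in> comp ?E a" and ueq: "u = (\<lambda>i\<in>I. \<Sum>a\<in>S. c a i)"
      using dual.homogeneous_decomposition[OF I u] by metis
    have pu: "pair u x = (\<Sum>a\<in>S. pair (c a) x)" if "x \<in> carrier ?F" for x
      using that sum.swap[of "\<lambda>i a. x (h i) \<star> c a i" S I]
      by (simp add: pair_def ueq dual_act_sum_right)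
    have "pair u = (\<lambda>x\<in>carrier ?F. \<Sum>a\<in>S. pair (c a) x)"
    proof
      fix x
      show "pair u x = (\<lambda>x\<in>carrier ?F. \<Sum>a\<in>S. pair (c a) x) x"
        using pu[of x] by (cases "x \<in> carrier ?F") (simp_all, simp add: pair_def)
    qed
    with c(1) pair_hom[OF c(2)] show ?thesis
      unfolding matlis_dual_carrier by (intro exI[of _ S] exI[of _ "\<lambda>a. pair (c a)"] conjI ballI)
  qed
  have pair_e: "pair u (e i) = u i" if "u \<in> carrier ?E" "i \<in> I" for u i
  proof -
    have "pair u (e i) = (\<Sum>l\<in>I. e i (h l) \<star> u l)"
      using e by (simp add: pair_def)
    also have "\<dots> = (\<Sum>l\<in>I. if l = i then 1 \<star> u i else 0)"
      using h by (intro sum.cong) (auto simp: e_def coord_vec_def inj_eq)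
    also have "\<dots> = u i"
      using that I by (auto intro: dual_act_one)
    finally show ?thesis .
  qed
  have pair_eval: "pair (\<lambda>i\<in>I. f (e i)) = f" if f: "f \<in> carrier (matlis_dual ?F)" for f
  proof
    fix x
    note fD = matlis_dual_carrierD[OF f Fcl]
    show "pair (\<lambda>i\<in>I. f (e i)) x = f x"
    proof (cases "x \<in> carrier ?F")
      case True
      have "f x = (\<Sum>j\<in>h ` I. f (coord_vec (h ` I) j (x j)))"
        using True fD(2) unfolding F by (intro poly.additive_eq_sum_coord_vec[OF J])
      also have "\<dots> = (\<Sum>i\<in>I. f (coord_vec (h ` I) (h i) (x (h i))))"
        using h by (simp add: sum.reindex inj_on_subset)
      also have "\<dots> = (\<Sum>i\<in>I. x (h i) \<star> f (e i))"
      proof (rule sum.cong[OF refl])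
        fix i
        have "coord_vec (h ` I) (h i) (x (h i)) = x (h i) \<odot>\<^bsub>?F\<^esub> e i"
          using poly.smult_coord_vec[of "h ` I" \<beta> "x (h i)" "h i" 1] by (simp add: e_def F)
        then show "f (coord_vec (h ` I) (h i) (x (h i))) = x (h i) \<star> f (e i)"
          using fD(3)[OF e] by simp
      qed
      finally show ?thesis
        using True by (simp add: pair_def)
    next
      case False
      then show ?thesis
        using fD(4) by (simp add: pair_def)
    qed
  qed
  have "graded_isomorphic ?E (matlis_dual ?F)"
  proof (rule graded_isomorphicI[OF _ Ecl])
    show "(\<lambda>u\<in>carrier ?E. pair u) \<in> graded_hom ?E (matlis_dual ?F)"
    proof (rule graded_hom_restrictI[OF Ecl])
      show "pair (p \<odot>\<^bsub>?E\<^esub> u) = p \<odot>\<^bsub>matlis_dual ?F\<^esub> pair u" for p u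
      proof
        have "q \<star> p \<star> v = p \<star> q \<star> v" for q and v :: "'n deg \<Rightarrow>\<^sub>0 'k"
          by (metis dual_act_mult mult.commute)
        then show "pair (p \<odot>\<^bsub>?E\<^esub> u) x = (p \<odot>\<^bsub>matlis_dual ?F\<^esub> pair u) x" for x
          by (simp add: pair_def dual_act_sum_right)
      qed
    qed (use pair_carrier pair_hom in
        \<open>auto simp: pair_def dual_act_add_right sum.distrib intro!: restrict_ext\<close>)
    show "comp (matlis_dual ?F) a \<subseteq> carrier (matlis_dual ?F)" for a
      using comp_subset_matlis_dual by simp
    show "(\<lambda>i\<in>I. f (e i)) \<in> carrier ?E" if "f \<in> carrier (matlis_dual ?F)" for f
      using matlis_dual_carrierD(1)[OF that Fcl e] I by simp
    show "(\<lambda>i\<in>I. f (e i)) \<in> comp ?E a" if f: "f \<in> comp (matlis_dual ?F) a" for f a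
    proof -
      have "f (e i) \<in> comp poly_dual (a - \<alpha> i)" if "i \<in> I" for i
      proof -
        have "(1 :: ('n, 'k) mpoly) \<in> poly_comp 0"
          by (simp add: one_eq_monom_at monom_at_in_poly_comp)
        from poly.coord_vec_comp[OF J, of 1 0 "h i" \<beta>] this
        have "e i \<in> comp (shift a ?F) (a - \<alpha> i)"
          using h by (simp add: e_def F \<beta>_def)
        then show ?thesis
          using f graded_homD(4) by fastforce
      qed
      then show ?thesis
        using I by simp
    qed
    show "(\<lambda>i\<in>I. ((\<lambda>u\<in>carrier ?E. pair u) u) (e i)) = u" if "u \<in> carrier ?E" for u
    proof -
      have "(\<lambda>i\<in>I. ((\<lambda>u\<in>carrier ?E. pair u) u) (e i)) = (\<lambda>i\<in>I. u i)"
        using that pair_e by (intro restrict_ext) simp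
      also have "\<dots> = u"
        using that I by (simp add: PiE_restrict)
      finally show ?thesis .
    qed
    show "(\<lambda>u\<in>carrier ?E. pair u) (\<lambda>i\<in>I. f (e i)) = f" if "f \<in> carrier (matlis_dual ?F)" for f
      using that pair_eval matlis_dual_carrierD(1)[OF that Fcl e] I by simp
  qed
  then show ?thesis
    by (simp add: \<beta>_def[abs_def])
qed

lemma graded_free_free_module:
  fixes I :: "'j set"
  assumes I: "finite I"
  shows "graded_free (free_module I \<beta> :: ('n::finite, 'k::field, 'j \<Rightarrow> ('n, 'k) mpoly) grmod)"
proof -
  define h :: "'j \<Rightarrow> 'j \<Rightarrow> ('n, 'k) mpoly" where "h j = (\<lambda>l. if l = j then 1 else 0)" for j
  have "inj h"
    by (intro injI) (metis h_def zero_neq_one)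
  from free_module_reindex[OF I this, of \<beta>] show ?thesis
    unfolding graded_free_def by blast
qed

lemma cofree_shifted_dual_sum:
  fixes I :: "'i set"
  assumes I: "finite I"
  shows "cofree (shifted_sum I \<alpha> poly_dual :: ('n::finite, 'k::field, 'i \<Rightarrow> 'n deg \<Rightarrow>\<^sub>0 'k) grmod)"
proof -
  define h :: "'i \<Rightarrow> 'i \<Rightarrow> 'n deg \<Rightarrow>\<^sub>0 'k"
    where "h i = (\<lambda>l. if l = i then Poly_Mapping.single 0 1 else 0)" for i
  have "Poly_Mapping.single (0 :: 'n deg) (1 :: 'k) \<noteq> 0"
    by (metis lookup_single_eq lookup_zero zero_neq_one)
  then have "inj h"
    by (intro injI) (metis h_def)
  from shifted_dual_sum_isomorphic[OF I this, of \<alpha>] show ?thesis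
    unfolding cofree_def by blast
qed

section \<open>The homomorphism of a monomial matrix\<close>

lemma mat_col_comp: "i \<in> rows A \<Longrightarrow> mat_col A j i \<in> comp poly_dual (gendeg A j - cogdeg A i)"
  by (simp add: mat_col_def dual_comp lookup_single when_def)

lemma mat_col_eq_single:
  "monomial_matrix A \<Longrightarrow> i \<in> rows A \<Longrightarrow> j \<in> cols A \<Longrightarrow>
    mat_col A j i = Poly_Mapping.single (gendeg A j - cogdeg A i) (entry A i j)"
  by (simp add: mat_col_def monomial_matrix_def)

text \<open>
  Transposition preserves not only the entries but also the degrees \<open>\<beta>_j - \<alpha>_i\<close> in which they
  live. This is what allows every statement on rows to be read off from one on columns.
\<close>

lemma mat_col_transpose:
  "i \<in> rows A \<Longrightarrow> j \<in> cols A \<Longrightarrow> mat_col (mat_transpose A) i j = mat_col A j i"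
  by (simp add: mat_col_def mat_transpose_def)

lemma mat_source_eq: "mat_source A = shifted_sum (cols A) (gendeg A) poly_module"
  by (simp add: mat_source_def free_module_def)

lemma graded_closed_mat_source: "finite (cols A) \<Longrightarrow> graded_closed (mat_source A)"
  by (simp add: mat_source_eq poly.graded_closed_shifted_sum)

lemma graded_closed_mat_target: "finite (rows A) \<Longrightarrow> graded_closed (mat_target A)"
  by (simp add: mat_target_def dual.graded_closed_shifted_sum)

lemma mat_source_carrier: "finite (cols A) \<Longrightarrow> carrier (mat_source A) = (\<Pi>\<^sub>E j\<in>cols A. UNIV)"
  by (simp add: mat_source_eq)

lemma mat_hom_apply:
  assumes fin: "finite (rows A)" "finite (cols A)" and x: "x \<in> carrier (mat_source A)"
  shows "mat_hom A x = (\<lambda>i\<in>rows A. \<Sum>j\<in>cols A. x j \<star> mat_col A j i)"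
proof -
  let ?S = "{j\<in>cols A. x j \<noteq> 0}"
  have "mat_hom A x = (\<lambda>i\<in>rows A. \<Sum>j\<in>?S. (x j \<odot>\<^bsub>mat_target A\<^esub> mat_col A j) i)"
    unfolding mat_hom_def restrict_apply'[OF x] using fin
    by (subst mat_target_def, intro dual.finsum_shifted_sum)
      (simp_all add: mat_target_def Pi_def dual_act_in_carrier)
  also have "\<dots> = (\<lambda>i\<in>rows A. \<Sum>j\<in>?S. x j \<star> mat_col A j i)"
    by (rule restrict_ext) (simp add: mat_target_def)
  also have "\<dots> = (\<lambda>i\<in>rows A. \<Sum>j\<in>cols A. x j \<star> mat_col A j i)"
    using fin by (intro restrict_ext sum.mono_neutral_left) auto
  finally show ?thesis .
qed

lemma mat_hom_graded_hom:
  assumes fin: "finite (rows A)" "finite (cols A)"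
  shows "mat_hom A \<in> graded_hom (mat_source A) (mat_target A)"
proof -
  have "(\<lambda>x\<in>carrier (mat_source A). \<lambda>i\<in>rows A. \<Sum>j\<in>cols A. x j \<star> mat_col A j i)
      \<in> graded_hom (mat_source A) (mat_target A)"
  proof (rule graded_hom_restrictI[OF graded_closed_mat_source[OF fin(2)]])
    fix x a
    assume x: "x \<in> comp (mat_source A) a"
    have "x j \<star> mat_col A j i \<in> comp poly_dual (a - cogdeg A i)" if "i \<in> rows A" "j \<in> cols A" for i j
    proof -
      have "x j \<in> poly_comp (a - gendeg A j)"
        using x fin that PiE_mem[of x "cols A" _ j] by (simp add: mat_source_eq)
      from dual_act_comp[OF this mat_col_comp[OF that(1), of j]] show ?thesis
        by simp
    qed
    then show "(\<lambda>i\<in>rows A. \<Sum>j\<in>cols A. x j \<star> mat_col A j i) \<in> comp (mat_target A) a"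
      using fin by (simp add: mat_target_def dual.sum_comp)
  qed (use fin in \<open>auto simp: mat_source_eq mat_target_def dual_act_add_left dual_act_mult
      dual_act_sum_right sum.distrib dual_act_in_carrier intro!: restrict_ext dual.sum_mem\<close>)
  moreover have "mat_hom A = (\<lambda>x\<in>carrier (mat_source A). \<lambda>i\<in>rows A. \<Sum>j\<in>cols A. x j \<star> mat_col A j i)"
  proof
    fix x
    show "mat_hom A x = (\<lambda>x\<in>carrier (mat_source A). \<lambda>i\<in>rows A. \<Sum>j\<in>cols A. x j \<star> mat_col A j i) x"
      using mat_hom_apply[OF fin, of x]
      by (cases "x \<in> carrier (mat_source A)") (simp_all, simp add: mat_hom_def)
  qed
  ultimately show ?thesis
    by simp
qed

lemma represents_presentationI:
  assumes "finite (rows A)" "finite (cols A)" "graded_module M"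
    and "graded_isomorphic (image_module (mat_source A) (mat_hom A) (mat_target A)) M"
  shows "represents_presentation A M"
  unfolding represents_presentation_def free_cofree_presentation_def
proof (intro conjI)
  show "graded_module (mat_source A)"
    using assms(2) by (simp add: mat_source_eq poly.graded_module_shifted_sum)
  show "graded_module (mat_target A)"
    using assms(1) by (simp add: mat_target_def dual.graded_module_shifted_sum)
  show "graded_free (mat_source A)"
    unfolding mat_source_def using assms(2) by (rule graded_free_free_module)
  show "cofree (mat_target A)"
    unfolding mat_target_def using assms(1) by (rule cofree_shifted_dual_sum)
  show "mat_hom A \<in> graded_hom (mat_source A) (mat_target A)"
    using assms(1,2) by (rule mat_hom_graded_hom)
qed (fact assms)+

section \<open>Redundant columns\<close>

definition redundant :: "('i, 'j, 'n::finite, 'k::field) monmat \<Rightarrow> 'j \<Rightarrow> bool" where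
  "redundant A j \<longleftrightarrow>
     solutions (rows A) (trunc_cols A j) (trunc A j) (\<lambda>i. entry A i j) \<noteq> {}"

definition irredundant :: "('i, 'j, 'n::finite, 'k::field) monmat \<Rightarrow> bool" where
  "irredundant A \<longleftrightarrow> (\<forall>j\<in>cols A. \<not> redundant A j)"

lemma redundant_iff:
  "redundant A j0 \<longleftrightarrow>
    (\<exists>y. \<forall>i\<in>rows A. (\<Sum>j\<in>trunc_cols A j0. trunc A j0 i j * y j) = entry A i j0)"
proof
  assume "redundant A j0"
  then show "\<exists>y. \<forall>i\<in>rows A. (\<Sum>j\<in>trunc_cols A j0. trunc A j0 i j * y j) = entry A i j0"
    unfolding redundant_def solutions_def by blast
next
  assume "\<exists>y. \<forall>i\<in>rows A. (\<Sum>j\<in>trunc_cols A j0. trunc A j0 i j * y j) = entry A i j0"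
  then obtain y where y: "\<forall>i\<in>rows A. (\<Sum>j\<in>trunc_cols A j0. trunc A j0 i j * y j) = entry A i j0"
    by blast
  have "(\<lambda>j\<in>trunc_cols A j0. y j) \<in>
      solutions (rows A) (trunc_cols A j0) (trunc A j0) (\<lambda>i. entry A i j0)"
    using y by (simp add: solutions_def)
  then show "redundant A j0"
    unfolding redundant_def by blast
qed

text \<open>
  A solution is extended by zero to the additional columns.
\<close>

lemma redundant_if_fewer_cols:
  assumes "finite (cols A)" "C \<subseteq> cols A" "redundant (A\<lparr>cols := C\<rparr>) j0"
  shows "redundant A j0"
proof -
  let ?B = "A\<lparr>cols := C\<rparr>"
  obtain y where y: "\<forall>i\<in>rows A. (\<Sum>j\<in>trunc_cols ?B j0. trunc ?B j0 i j * y j) = entry A i j0"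
    using assms(3) unfolding redundant_iff by auto
  have "(\<Sum>j\<in>trunc_cols A j0. trunc A j0 i j * (if j \<in> C then y j else 0))
      = (\<Sum>j\<in>trunc_cols ?B j0. trunc ?B j0 i j * y j)" for i
    using assms(1,2) by (intro sum.mono_neutral_cong_right) (auto simp: trunc_cols_def trunc_def)
  with y show ?thesis
    unfolding redundant_iff by (intro exI[of _ "\<lambda>j. if j \<in> C then y j else 0"]) simp
qed

lemma single_sum: "Poly_Mapping.single a (\<Sum>x\<in>S. f x) = (\<Sum>x\<in>S. Poly_Mapping.single a (f x))"
  by (induction S rule: infinite_finite_induct) (simp_all add: single_add)

text \<open>
  The coefficient of column \<open>j\<close> is \<open>y_j X^(\<beta>_j0 - \<beta>_j)\<close>. In row \<open>i\<close> the product with the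
  entry of column \<open>j\<close> lives in degree \<open>\<beta>_j0 - \<alpha>_i\<close>, and it is truncated to \<open>0\<close> exactly when
  \<open>\<beta>_j0 \<le> \<alpha>_i\<close> fails, which is how the truncated matrix is defined.
\<close>

lemma redundant_column_combination:
  assumes A: "monomial_matrix A" and j0: "j0 \<in> cols A" and red: "redundant A j0"
  obtains q where "\<And>j. q j \<in> poly_comp (gendeg A j0 - gendeg A j)"
    and "\<And>i. i \<in> rows A \<Longrightarrow> mat_col A j0 i = (\<Sum>j\<in>trunc_cols A j0. q j \<star> mat_col A j i)"
proof -
  obtain y where y: "\<forall>i\<in>rows A. (\<Sum>j\<in>trunc_cols A j0. trunc A j0 i j * y j) = entry A i j0"
    using red unfolding redundant_iff by blast
  define q where "q j = monom_at (gendeg A j0 - gendeg A j) (y j)" for j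
  have "mat_col A j0 i = (\<Sum>j\<in>trunc_cols A j0. q j \<star> mat_col A j i)" if i: "i \<in> rows A" for i
  proof -
    have "q j \<star> mat_col A j i =
        Poly_Mapping.single (gendeg A j0 - cogdeg A i) (trunc A j0 i j * y j)"
      if j: "j \<in> trunc_cols A j0" for j
    proof -
      have "j \<in> cols A" "gendeg A j \<le> gendeg A j0"
        using j by (auto simp: trunc_cols_def)
      then show ?thesis
        by (simp add: q_def mat_col_eq_single[OF A i] monom_at_dual_act_single trunc_def mult.commute)
    qed
    then have "(\<Sum>j\<in>trunc_cols A j0. q j \<star> mat_col A j i) =
        (\<Sum>j\<in>trunc_cols A j0. Poly_Mapping.single (gendeg A j0 - cogdeg A i) (trunc A j0 i j * y j))"
      by (rule sum.cong[OF refl])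
    also have "\<dots> = Poly_Mapping.single (gendeg A j0 - cogdeg A i)
        (\<Sum>j\<in>trunc_cols A j0. trunc A j0 i j * y j)"
      by (simp only: single_sum)
    also have "\<dots> = mat_col A j0 i"
      using y i by (simp add: mat_col_eq_single[OF A i j0])
    finally show ?thesis ..
  qed
  moreover have "q j \<in> poly_comp (gendeg A j0 - gendeg A j)" for j
    by (simp add: q_def monom_at_in_poly_comp)
  ultimately show thesis
    using that by blast
qed

abbreviation mat_image :: "('i, 'j, 'n::finite, 'k::field) monmat \<Rightarrow> _" where
  "mat_image A \<equiv> image_module (mat_source A) (mat_hom A) (mat_target A)"

text \<open>
  Both inclusions rewrite the coordinate vector: a vector of the smaller source is extended by
  zero, and in a vector of the larger source the summand at \<open>j0\<close> is redistributed to the other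
  columns.
\<close>

lemma mat_image_remove_col:
  assumes fin: "finite (rows A)" "finite (cols A)"
    and A: "monomial_matrix A" and j0: "j0 \<in> cols A" and red: "redundant A j0"
  shows "mat_image (A\<lparr>cols := cols A - {j0}\<rparr>) = mat_image A"
proof -
  define B where "B = A\<lparr>cols := cols A - {j0}\<rparr>"
  let ?C = "cols A - {j0}"
  have B: "rows B = rows A" "cols B = ?C" "mat_target B = mat_target A"
    by (simp_all add: B_def mat_target_def)
  have finB: "finite (rows B)" "finite (cols B)"
    using fin B by simp_all
  have colB: "mat_col B j = mat_col A j" for j
    by (simp add: mat_col_def B_def cong: if_cong)
  have srcA: "carrier (mat_source A) = (\<Pi>\<^sub>E j\<in>cols A. UNIV)"
    and srcB: "carrier (mat_source B) = (\<Pi>\<^sub>E j\<in>?C. UNIV)"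
    using mat_source_carrier[OF fin(2)] mat_source_carrier[OF finB(2)] B by simp_all
  obtain q where q: "\<And>i. i \<in> rows A \<Longrightarrow> mat_col A j0 i = (\<Sum>j\<in>trunc_cols A j0. q j \<star> mat_col A j i)"
    using redundant_column_combination[OF A j0 red] by blast
  have tr: "trunc_cols A j0 \<subseteq> ?C"
    by (auto simp: trunc_cols_def)
  have "mat_hom B ` carrier (mat_source B) \<subseteq> mat_hom A ` carrier (mat_source A)"
  proof (rule image_subsetI)
    fix x
    assume x: "x \<in> carrier (mat_source B)"
    define x' where "x' = (\<lambda>j\<in>cols A. if j = j0 then 0 else x j)"
    have x': "x' \<in> carrier (mat_source A)"
      by (simp add: srcA x'_def)
    have "(\<Sum>j\<in>?C. x j \<star> mat_col A j i) = (\<Sum>j\<in>cols A. x' j \<star> mat_col A j i)" for i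
      using fin by (intro sum.mono_neutral_cong_left) (auto simp: x'_def)
    then have "mat_hom B x = mat_hom A x'"
      by (simp add: mat_hom_apply[OF fin x'] mat_hom_apply[OF finB x] B colB)
    then show "mat_hom B x \<in> mat_hom A ` carrier (mat_source A)"
      using x' by simp
  qed
  moreover have "mat_hom A ` carrier (mat_source A) \<subseteq> mat_hom B ` carrier (mat_source B)"
  proof (rule image_subsetI)
    fix x
    assume x: "x \<in> carrier (mat_source A)"
    define x' where "x' = (\<lambda>j\<in>?C. x j + (if j \<in> trunc_cols A j0 then x j0 * q j else 0))"
    have x': "x' \<in> carrier (mat_source B)"
      by (simp add: srcB x'_def)
    have "(\<Sum>j\<in>?C. x' j \<star> mat_col A j i) = (\<Sum>j\<in>cols A. x j \<star> mat_col A j i)"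
      if i: "i \<in> rows A" for i
    proof -
      have "(\<Sum>j\<in>?C. x' j \<star> mat_col A j i) = (\<Sum>j\<in>?C. x j \<star> mat_col A j i) +
          (\<Sum>j\<in>?C. if j \<in> trunc_cols A j0 then x j0 \<star> q j \<star> mat_col A j i else 0)"
        unfolding sum.distrib[symmetric]
        by (rule sum.cong[OF refl]) (simp add: x'_def dual_act_add_left dual_act_mult)
      also have "(\<Sum>j\<in>?C. if j \<in> trunc_cols A j0 then x j0 \<star> q j \<star> mat_col A j i else 0)
          = (\<Sum>j\<in>trunc_cols A j0. x j0 \<star> q j \<star> mat_col A j i)"
        using tr fin by (intro sum.mono_neutral_cong_right) auto
      also have "\<dots> = x j0 \<star> mat_col A j0 i"
        by (simp add: q[OF i] dual_act_sum_right)
      also have "(\<Sum>j\<in>?C. x j \<star> mat_col A j i) + x j0 \<star> mat_col A j0 i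
          = (\<Sum>j\<in>cols A. x j \<star> mat_col A j i)"
        using fin(2) j0 by (simp add: sum.remove add.commute)
      finally show ?thesis .
    qed
    then have "mat_hom A x = mat_hom B x'"
      unfolding mat_hom_apply[OF fin x] mat_hom_apply[OF finB x'] B colB
      by (intro restrict_ext) simp
    then show "mat_hom A x \<in> mat_hom B ` carrier (mat_source B)"
      using x' by simp
  qed
  ultimately have "mat_hom B ` carrier (mat_source B) = mat_hom A ` carrier (mat_source A)"
    by blast
  then show ?thesis
    by (simp add: image_module_def B B_def[symmetric])
qed

lemma mat_transpose_simps [simp]:
  "rows (mat_transpose A) = cols A" "cols (mat_transpose A) = rows A"
  "gendeg (mat_transpose A) i = - cogdeg A i" "cogdeg (mat_transpose A) j = - gendeg A j"
  "entry (mat_transpose A) j i = entry A i j"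
  by (simp_all add: mat_transpose_def)

lemma mat_transpose_transpose: "mat_transpose (mat_transpose A) = A"
  by (simp add: mat_transpose_def)

lemma monomial_matrix_transpose: "monomial_matrix (mat_transpose A) \<longleftrightarrow> monomial_matrix A"
  by (auto simp: monomial_matrix_def)

lemma redundant_row_combination:
  assumes A: "monomial_matrix A" and i0: "i0 \<in> rows A" and red: "redundant (mat_transpose A) i0"
  obtains q where "\<And>i. q i \<in> poly_comp (cogdeg A i - cogdeg A i0)"
    and "\<And>j. j \<in> cols A \<Longrightarrow>
      mat_col A j i0 = (\<Sum>i\<in>trunc_cols (mat_transpose A) i0. q i \<star> mat_col A j i)"
proof -
  obtain q where q: "\<And>i. q i \<in> poly_comp (gendeg (mat_transpose A) i0 - gendeg (mat_transpose A) i)"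
    and col: "\<And>j. j \<in> rows (mat_transpose A) \<Longrightarrow> mat_col (mat_transpose A) i0 j =
      (\<Sum>i\<in>trunc_cols (mat_transpose A) i0. q i \<star> mat_col (mat_transpose A) i j)"
    using redundant_column_combination[of "mat_transpose A" i0] A i0 red
    by (auto simp: monomial_matrix_transpose)
  have "q i \<in> poly_comp (cogdeg A i - cogdeg A i0)" for i
    using q[of i] by simp
  moreover have "mat_col A j i0 = (\<Sum>i\<in>trunc_cols (mat_transpose A) i0. q i \<star> mat_col A j i)"
    if j: "j \<in> cols A" for j
  proof -
    have "i \<in> rows A" if "i \<in> trunc_cols (mat_transpose A) i0" for i
      using that by (simp add: trunc_cols_def)
    then show ?thesis
      using col[of j] j i0 by (simp add: mat_col_transpose cong: sum.cong)
  qed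
  ultimately show thesis
    using that by blast
qed

text \<open>
  On the image, the coordinate at \<open>i0\<close> equals \<open>\<Sum>i. q_i z_i\<close> for fixed \<open>q_i\<close> of degree
  \<open>\<alpha>_i - \<alpha>_i0\<close>, because this holds for the images of the basis elements. So the map \<open>extend\<close>, which
  recomputes the missing coordinate, is a graded homomorphism inverse to forgetting it.
\<close>

lemma mat_image_remove_row:
  assumes fin: "finite (rows A)" "finite (cols A)"
    and A: "monomial_matrix A" and i0: "i0 \<in> rows A" and red: "redundant (mat_transpose A) i0"
  shows "graded_isomorphic (mat_image (A\<lparr>rows := rows A - {i0}\<rparr>)) (mat_image A)"
proof -
  define B where "B = A\<lparr>rows := rows A - {i0}\<rparr>"
  let ?R = "rows A - {i0}"
  let ?T = "trunc_cols (mat_transpose A) i0"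
  have B: "rows B = ?R" "cols B = cols A" "mat_source B = mat_source A" "cogdeg B = cogdeg A"
    by (simp_all add: B_def mat_source_def)
  have finB: "finite (rows B)" "finite (cols B)"
    using fin B by simp_all
  have colB: "mat_col B j i = mat_col A j i" if "i \<in> ?R" for i j
    using that by (simp add: mat_col_def B_def)
  obtain q where qc: "\<And>i. q i \<in> poly_comp (cogdeg A i - cogdeg A i0)"
    and q: "\<And>j. j \<in> cols A \<Longrightarrow> mat_col A j i0 = (\<Sum>i\<in>?T. q i \<star> mat_col A j i)"
    using redundant_row_combination[OF A i0 red] by blast
  have T: "?T \<subseteq> ?R"
    by (auto simp: trunc_cols_def)
  define extend where "extend z = (\<lambda>i\<in>rows A. if i = i0 then \<Sum>i\<in>?T. q i \<star> z i else z i)"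
    for z :: "'a \<Rightarrow> 'c deg \<Rightarrow>\<^sub>0 'd"
  have restr: "(\<lambda>i\<in>?R. mat_hom A x i) = mat_hom B x" if x: "x \<in> carrier (mat_source A)" for x
  proof -
    have xB: "x \<in> carrier (mat_source B)"
      using x B by simp
    show ?thesis
      unfolding mat_hom_apply[OF fin x] mat_hom_apply[OF finB xB] B
      by (rule restrict_ext) (simp add: colB)
  qed
  have ext: "extend (mat_hom B x) = mat_hom A x" if x: "x \<in> carrier (mat_source A)" for x
  proof -
    have hB: "mat_hom B x i = mat_hom A x i" if "i \<in> ?R" for i
      using restr[OF x, symmetric] that by simp
    have hA: "mat_hom A x i = (\<Sum>j\<in>cols A. x j \<star> mat_col A j i)" if "i \<in> rows A" for i
      using mat_hom_apply[OF fin x] that by simp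
    have swap: "p \<star> r \<star> u = r \<star> p \<star> u" for p r and u :: "'c deg \<Rightarrow>\<^sub>0 'd"
      by (metis dual_act_mult mult.commute)
    have "(\<Sum>i\<in>?T. q i \<star> mat_hom B x i) = (\<Sum>i\<in>?T. \<Sum>j\<in>cols A. x j \<star> q i \<star> mat_col A j i)"
    proof (rule sum.cong[OF refl])
      fix i
      assume i: "i \<in> ?T"
      then have "i \<in> ?R" "i \<in> rows A"
        using T by auto
      then show "q i \<star> mat_hom B x i = (\<Sum>j\<in>cols A. x j \<star> q i \<star> mat_col A j i)"
        by (simp add: hB hA dual_act_sum_right swap[of "q i"])
    qed
    also have "\<dots> = (\<Sum>j\<in>cols A. x j \<star> (\<Sum>i\<in>?T. q i \<star> mat_col A j i))"
      by (simp add: dual_act_sum_right) (rule sum.swap)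
    also have "\<dots> = mat_hom A x i0"
      using hA[OF i0] q by simp
    finally have "extend (mat_hom B x) = (\<lambda>i\<in>rows A. mat_hom A x i)"
      unfolding extend_def using hB by (intro restrict_ext) simp
    also have "\<dots> = mat_hom A x"
      by (simp add: mat_hom_apply[OF fin x] cong: restrict_cong)
    finally show ?thesis .
  qed
  have carA: "carrier (mat_image A) = mat_hom A ` carrier (mat_source A)"
    and carB: "carrier (mat_image B) = mat_hom B ` carrier (mat_source A)"
    by (simp_all add: image_module_def B)
  have compA: "comp (mat_image A) a = comp (mat_target A) a \<inter> carrier (mat_image A)"
    and compB: "comp (mat_image B) a = comp (mat_target B) a \<inter> carrier (mat_image B)" for a
    by (simp_all add: image_module_def)
  have opsA: "y \<oplus>\<^bsub>mat_image A\<^esub> z = (\<lambda>i\<in>rows A. y i + z i)"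
      "p \<odot>\<^bsub>mat_image A\<^esub> y = (\<lambda>i\<in>rows A. p \<star> y i)"
    and opsB: "y \<oplus>\<^bsub>mat_image B\<^esub> z = (\<lambda>i\<in>?R. y i + z i)"
      "p \<odot>\<^bsub>mat_image B\<^esub> y = (\<lambda>i\<in>?R. p \<star> y i)" for y z p
    by (simp_all add: image_module_def mat_target_def B)
  have closed: "graded_closed (mat_image B)"
    by (rule graded_closed_image[OF mat_hom_graded_hom[OF finB] graded_closed_mat_source[OF finB(2)]])
  have extA: "extend z \<in> carrier (mat_image A)" if "z \<in> carrier (mat_image B)" for z
    using that ext unfolding carA carB by auto
  have restB: "(\<lambda>i\<in>?R. y i) \<in> carrier (mat_image B)" if "y \<in> carrier (mat_image A)" for y
    using that restr unfolding carA carB by auto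
  have "graded_isomorphic (mat_image B) (mat_image A)"
  proof (rule graded_isomorphicI[OF _ closed])
    show "(\<lambda>z\<in>carrier (mat_image B). extend z) \<in> graded_hom (mat_image B) (mat_image A)"
    proof (rule graded_hom_restrictI[OF closed extA])
      fix y z
      have "(\<Sum>i\<in>?T. q i \<star> (\<lambda>i\<in>?R. y i + z i) i) = (\<Sum>i\<in>?T. q i \<star> y i + q i \<star> z i)"
        using T by (intro sum.cong) (auto simp: dual_act_add_right)
      then show "extend (y \<oplus>\<^bsub>mat_image B\<^esub> z) = extend y \<oplus>\<^bsub>mat_image A\<^esub> extend z"
        unfolding opsA opsB extend_def by (intro restrict_ext) (simp add: sum.distrib)
    next
      fix p z
      have "p \<star> q i \<star> u = q i \<star> p \<star> u" for i and u :: "'c deg \<Rightarrow>\<^sub>0 'd"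
        by (metis dual_act_mult mult.commute)
      then have "(\<Sum>i\<in>?T. q i \<star> (\<lambda>i\<in>?R. p \<star> z i) i) = (\<Sum>i\<in>?T. p \<star> q i \<star> z i)"
        using T by (intro sum.cong) auto
      then show "extend (p \<odot>\<^bsub>mat_image B\<^esub> z) = p \<odot>\<^bsub>mat_image A\<^esub> extend z"
        unfolding opsA opsB extend_def by (intro restrict_ext) (simp add: dual_act_sum_right)
    next
      fix a z
      assume z: "z \<in> comp (mat_image B) a"
      then have "z \<in> comp (mat_target B) a"
        by (simp add: compB)
      then have zi: "z i \<in> comp poly_dual (a - cogdeg A i)" if "i \<in> ?R" for i
        using that PiE_mem[of z ?R _ i] finB by (simp add: mat_target_def B)
      have "q i \<star> z i \<in> comp poly_dual (a - cogdeg A i0)" if "i \<in> ?T" for i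
        using dual_act_comp[OF qc[of i] zi[of i]] that T by auto
      then have "(\<Sum>i\<in>?T. q i \<star> z i) \<in> comp poly_dual (a - cogdeg A i0)"
        by (rule dual.sum_comp)
      then have "extend z \<in> comp (mat_target A) a"
        using zi fin by (simp add: mat_target_def extend_def)
      with z show "extend z \<in> comp (mat_image A) a"
        using extA by (simp add: compA compB)
    qed
    show "comp (mat_image A) a \<subseteq> carrier (mat_image A)" for a
      by (simp add: compA)
    show "(\<lambda>i\<in>?R. y i) \<in> carrier (mat_image B)" if "y \<in> carrier (mat_image A)" for y
      using that by (rule restB)
    show "(\<lambda>i\<in>?R. y i) \<in> comp (mat_image B) a" if y: "y \<in> comp (mat_image A) a" for y a
    proof -
      have "y \<in> comp (mat_target A) a"
        using y by (simp add: compA)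
      then have "(\<lambda>i\<in>?R. y i) \<in> comp (mat_target B) a"
        using fin PiE_mem[of y "rows A" "\<lambda>i. comp poly_dual (a - cogdeg A i)"]
        by (simp add: mat_target_def B)
      then show ?thesis
        using y restB by (simp add: compA compB)
    qed
    show "(\<lambda>i\<in>?R. (\<lambda>z\<in>carrier (mat_image B). extend z) z i) = z"
      if z: "z \<in> carrier (mat_image B)" for z
    proof -
      obtain x where x: "x \<in> carrier (mat_source A)" "z = mat_hom B x"
        using z unfolding carB by blast
      show ?thesis
        unfolding restrict_apply'[OF z] unfolding x(2) ext[OF x(1)] by (rule restr[OF x(1)])
    qed
    show "(\<lambda>z\<in>carrier (mat_image B). extend z) (\<lambda>i\<in>?R. y i) = y" if y: "y \<in> carrier (mat_image A)" for y
    proof -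
      obtain x where x: "x \<in> carrier (mat_source A)" "y = mat_hom A x"
        using y unfolding carA by blast
      show ?thesis
        unfolding restrict_apply'[OF restB[OF y]] unfolding x(2) restr[OF x(1)] by (rule ext[OF x(1)])
    qed
  qed
  then show ?thesis
    by (simp add: B_def)
qed

section \<open>The reduction procedure\<close>

lemma rg_step_eq:
  "rg_step j A = (if redundant A j then A\<lparr>cols := cols A - {j}\<rparr> else A)"
  by (simp add: rg_step_def redundant_def)

lemma rg_step_restricts_cols:
  obtains C where "rg_step j A = A\<lparr>cols := C\<rparr>" "C \<subseteq> cols A"
proof (cases "redundant A j")
  case True
  then show thesis
    using that[of "cols A - {j}"] by (auto simp: rg_step_eq)
next
  case False
  then show thesis
    using that[of "cols A"] by (simp add: rg_step_eq)
qed

lemma rg_restricts_cols: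
  "\<exists>C. rg js A = A\<lparr>cols := C\<rparr> \<and> C \<subseteq> cols A"
proof (induction js arbitrary: A)
  case Nil
  show ?case
    by (rule exI[of _ "cols A"]) (simp add: rg_def)
next
  case (Cons j js)
  obtain C where C: "rg_step j A = A\<lparr>cols := C\<rparr>" "C \<subseteq> cols A"
    by (rule rg_step_restricts_cols)
  obtain D where D: "rg js (rg_step j A) = (rg_step j A)\<lparr>cols := D\<rparr>" "D \<subseteq> cols (rg_step j A)"
    using Cons by blast
  then have "rg (j # js) A = A\<lparr>cols := D\<rparr>" "D \<subseteq> cols A"
    using C by (simp_all add: rg_def)
  then show ?case
    by blast
qed

text \<open>
  A column that survives was not redundant when its turn came. The columns of the final matrix are
  among those present at that moment, so it is not redundant at the end either.
\<close>

lemma rg_not_redundant: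
  assumes "finite (cols A)" "j \<in> set js" "j \<in> cols (rg js A)"
  shows "\<not> redundant (rg js A) j"
  using assms
proof (induction js arbitrary: A)
  case (Cons l js)
  let ?B = "rg_step l A"
  have rg: "rg (l # js) A = rg js ?B"
    by (simp add: rg_def)
  obtain C where C: "?B = A\<lparr>cols := C\<rparr>" "C \<subseteq> cols A"
    by (rule rg_step_restricts_cols)
  obtain D where D: "rg js ?B = ?B\<lparr>cols := D\<rparr>" "D \<subseteq> cols ?B"
    using rg_restricts_cols[of js ?B] by blast
  have fin: "finite (cols ?B)"
    using C Cons.prems(1) finite_subset by auto
  show ?case
  proof (cases "j \<in> set js")
    case True
    with Cons.IH[OF fin True] Cons.prems(3) show ?thesis
      by (simp add: rg)
  next
    case False
    then have "j = l" "j \<in> cols ?B"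
      using Cons.prems(2,3) D by (auto simp: rg)
    then have "\<not> redundant A j" "?B = A"
      by (auto simp: rg_step_eq split: if_splits)
    then show ?thesis
      using redundant_if_fewer_cols[of A D j] Cons.prems(1) D by (auto simp: rg)
  qed
qed simp

lemma rg_irredundant:
  assumes "finite (cols A)" "cols A \<subseteq> set js"
  shows "irredundant (rg js A)"
proof -
  obtain C where C: "rg js A = A\<lparr>cols := C\<rparr>" "C \<subseteq> cols A"
    using rg_restricts_cols[of js A] by blast
  have "\<not> redundant (rg js A) j" if "j \<in> cols (rg js A)" for j
    using rg_not_redundant[OF assms(1) _ that] that C assms(2) by auto
  then show ?thesis
    by (simp add: irredundant_def)
qed

lemma rg_invariant:
  assumes "P A"
    and step: "\<And>A j. P A \<Longrightarrow> j \<in> cols A \<Longrightarrow> redundant A j \<Longrightarrow> P (A\<lparr>cols := cols A - {j}\<rparr>)"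
  shows "P (rg js A)"
  using assms(1)
proof (induction js arbitrary: A)
  case (Cons j js)
  have "P (rg_step j A)"
    using Cons.prems step[of A j] by (cases "j \<in> cols A") (auto simp: rg_step_eq)
  then show ?case
    using Cons.IH by (simp add: rg_def)
qed (simp add: rg_def)

text \<open>
  The row \<open>i0\<close> is a combination of rows \<open>i\<close> with \<open>\<alpha>_i \<ge> \<alpha>_i0\<close>, valid in all columns \<open>j\<close> with
  \<open>\<beta>_j \<le> \<alpha>_i0\<close>. If \<open>\<beta>_j0 \<le> \<alpha>_i0\<close>, then this covers all columns in the system of \<open>j0\<close>, so its equation for
  \<open>i0\<close> is the same combination of the equations for the other rows. Otherwise that equation reads
  \<open>0 = 0\<close>.
\<close>

lemma redundant_if_fewer_rows:
  assumes A: "monomial_matrix A" and j0: "j0 \<in> cols A"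
    and i0: "i0 \<in> rows A" and row: "redundant (mat_transpose A) i0"
    and red: "redundant (A\<lparr>rows := rows A - {i0}\<rparr>) j0"
  shows "redundant A j0"
proof -
  let ?T = "trunc_cols A j0" and ?S = "trunc_cols (mat_transpose A) i0"
  have tr: "trunc_cols (A\<lparr>rows := rows A - {i0}\<rparr>) j0 = ?T"
      "trunc (A\<lparr>rows := rows A - {i0}\<rparr>) j0 = trunc A j0"
    by (simp_all add: trunc_cols_def trunc_def fun_eq_iff)
  obtain y where y: "\<And>i. i \<in> rows A - {i0} \<Longrightarrow> (\<Sum>j\<in>?T. trunc A j0 i j * y j) = entry A i j0"
    using red unfolding redundant_iff tr by auto
  obtain z where z: "\<And>j. j \<in> cols A \<Longrightarrow>
      (\<Sum>i\<in>?S. trunc (mat_transpose A) i0 j i * z i) = entry A i0 j"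
    using row unfolding redundant_iff by auto
  have "(\<Sum>j\<in>?T. trunc A j0 i0 j * y j) = entry A i0 j0"
  proof (cases "gendeg A j0 \<le> cogdeg A i0")
    case True
    \<comment> \<open>Here all the \<open>\<beta>_j\<close> involved are at most \<open>\<alpha>_i0\<close>, and all the \<open>\<alpha>_i\<close> are at least \<open>\<beta>_j0\<close>, so that
      no truncation takes place.\<close>
    have row: "entry A i0 j = (\<Sum>i\<in>?S. entry A i j * z i)" if "j \<in> cols A" "gendeg A j \<le> gendeg A j0" for j
      using z[OF that(1)] order_trans[OF that(2) True] by (simp add: trunc_def)
    have sub: "i \<in> rows A - {i0}" "gendeg A j0 \<le> cogdeg A i" if "i \<in> ?S" for i
      using that True by (auto simp: trunc_cols_def)
    have "(\<Sum>j\<in>?T. trunc A j0 i0 j * y j) = (\<Sum>j\<in>?T. \<Sum>i\<in>?S. entry A i j * z i * y j)"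
      using True row by (intro sum.cong) (auto simp: trunc_def trunc_cols_def sum_distrib_right)
    also have "\<dots> = (\<Sum>i\<in>?S. \<Sum>j\<in>?T. entry A i j * z i * y j)"
      by (rule sum.swap)
    also have "\<dots> = (\<Sum>i\<in>?S. (\<Sum>j\<in>?T. trunc A j0 i j * y j) * z i)"
      using sub by (intro sum.cong refl) (simp add: trunc_def sum_distrib_left sum_distrib_right mult_ac)
    also have "\<dots> = (\<Sum>i\<in>?S. entry A i j0 * z i)"
      using sub y by (intro sum.cong refl) simp
    also have "\<dots> = entry A i0 j0"
      using row[OF j0] by simp
    finally show ?thesis .
  next
    case False
    then show ?thesis
      using A i0 j0 by (simp add: trunc_def monomial_matrix_def)
  qed
  then show ?thesis
    unfolding redundant_iff using y by (intro exI[of _ y]) blast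
qed

section \<open>Irredundant matrices are minimal\<close>

text \<open>
  In the relation for row \<open>i\<close>, the coefficient in degree \<open>\<beta>_j0 - \<alpha>_i\<close> involves only columns with
  \<open>\<beta>_j \<le> \<beta>_j0\<close>. A nonzero constant coefficient at \<open>j0\<close> allows to solve for the entry in column \<open>j0\<close>,
  with the same \<open>y\<close> for all rows.
  
  The vector \<open>p\<close> is not required to be an element of the source, so that the lemma also applies to the
  transpose with the coefficients of an element of the Matlis dual.
\<close>

lemma constant_coeff_zero:
  assumes A: "monomial_matrix A" and fin: "finite (cols A)" and irr: "irredundant A"
    and rel: "\<And>i. i \<in> rows A \<Longrightarrow> (\<Sum>j\<in>cols A. p j \<star> mat_col A j i) = 0"
    and j0: "j0 \<in> cols A"
  shows "pcoeff (p j0) 0 = 0"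
proof (rule ccontr)
  define c where "c = pcoeff (p j0) 0"
  assume "pcoeff (p j0) 0 \<noteq> 0"
  then have c: "c \<noteq> 0"
    by (simp add: c_def)
  let ?T = "trunc_cols A j0"
  define y where "y j = - (pcoeff (p j) (gendeg A j0 - gendeg A j) / c)" for j
  have "(\<Sum>j\<in>?T. trunc A j0 i j * y j) = entry A i j0" if i: "i \<in> rows A" for i
  proof (cases "gendeg A j0 \<le> cogdeg A i")
    case True
    let ?w = "\<lambda>j. pcoeff (p j) (gendeg A j0 - gendeg A j) * entry A i j"
    \<comment> \<open>The degree \<open>\<beta>_j0 - \<alpha>_i\<close> of the \<open>i\<close>-th summand of the target is degree \<open>\<beta>_j0\<close> before the shift.\<close>
    have "0 = (\<Sum>j\<in>cols A. Poly_Mapping.lookup (p j \<star> mat_col A j i) (gendeg A j0 - cogdeg A i))"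
      unfolding lookup_sum[symmetric] rel[OF i] by simp
    also have "\<dots> = (\<Sum>j\<in>cols A. ?w j)"
      using True by (intro sum.cong refl) (simp add: mat_col_eq_single[OF A i] dual_act_single)
    also have "\<dots> = ?w j0 + (\<Sum>j\<in>cols A - {j0}. ?w j)"
      by (rule sum.remove[OF fin j0])
    also have "(\<Sum>j\<in>cols A - {j0}. ?w j) = (\<Sum>j\<in>?T. ?w j)"
    proof (intro sum.mono_neutral_right ballI)
      fix j
      assume "j \<in> cols A - {j0} - ?T"
      then have "\<not> 0 \<le> gendeg A j0 - gendeg A j"
        by (auto simp: trunc_cols_def)
      then show "?w j = 0"
        by (simp add: pcoeff_not_nonneg)
    qed (use fin in \<open>auto simp: trunc_cols_def\<close>)
    also have "?w j0 = c * entry A i j0"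
      unfolding c_def diff_self ..
    finally have "0 = c * entry A i j0 + (\<Sum>j\<in>?T. ?w j)" .
    from minus_unique[OF this[symmetric]] have "(\<Sum>j\<in>?T. ?w j) = - (c * entry A i j0)" ..
    moreover have "(\<Sum>j\<in>?T. trunc A j0 i j * y j) = (\<Sum>j\<in>?T. ?w j) * (- inverse c)"
      using True by (simp add: trunc_def y_def sum_distrib_left sum_distrib_right sum_negf divide_inverse mult_ac)
    ultimately show ?thesis
      using c by simp
  next
    case False
    then show ?thesis
      using A i j0 by (simp add: trunc_def monomial_matrix_def)
  qed
  then have "redundant A j0"
    unfolding redundant_iff by blast
  with irr j0 show False
    by (simp add: irredundant_def)
qed

text \<open>
  Every monomial other than \<open>1\<close> is divisible by a variable.
\<close>

lemma max_idealI:
  fixes p :: "('n::finite, 'k::field) mpoly"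
  assumes "pcoeff p 0 = 0"
  shows "p \<in> max_ideal"
  unfolding max_ideal_def genideal_def
proof (clarify)
  fix I :: "('n, 'k) mpoly set"
  assume I: "ideal I poly_ring" and Var: "range Var \<subseteq> I"
  interpret ideal I poly_ring
    by (rule I)
  have mono: "Poly_Mapping.single \<mu> c \<in> I" if "\<mu> \<noteq> 0" for \<mu> :: "'n \<Rightarrow> nat" and c :: 'k
  proof -
    have "\<mu> = 0" if "\<forall>l. \<mu> l = 0"
      using that by (intro ext) simp
    with that obtain l where l: "\<mu> l \<noteq> 0"
      by blast
    define \<nu> where "\<nu> = (\<lambda>l'. if l' = l then \<mu> l' - 1 else \<mu> l')"
    have "\<nu> + (\<lambda>l'. if l' = l then 1 else 0) = \<mu>"
      using l by (auto simp: \<nu>_def fun_eq_iff)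
    then have "Poly_Mapping.single \<mu> c = Poly_Mapping.single \<nu> c * Var l"
      by (simp add: Var_def mult_single)
    moreover have "Poly_Mapping.single \<nu> c * Var l \<in> I"
      using I_l_closed[of "Var l" "Poly_Mapping.single \<nu> c"] Var by auto
    ultimately show ?thesis
      by simp
  qed
  have "mdeg (0 :: 'n \<Rightarrow> nat) = 0"
    by (simp add: mdeg_def fun_eq_iff)
  then have "Poly_Mapping.lookup p 0 = 0"
    using assms pcoeff_mdeg[of p 0] by simp
  then have mem: "Poly_Mapping.single \<mu> (Poly_Mapping.lookup p \<mu>) \<in> I" if "\<mu> \<in> Poly_Mapping.keys p" for \<mu>
    using that mono[of \<mu>] by (auto simp: in_keys_iff)
  have sum_mem: "(\<Sum>x\<in>S. f x) \<in> I" if "\<And>x. x \<in> S \<Longrightarrow> f x \<in> I"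
    for S :: "('n \<Rightarrow> nat) set" and f :: "_ \<Rightarrow> ('n, 'k) mpoly"
    using that
  proof (induction S rule: infinite_finite_induct)
    case (insert x S)
    then show ?case
      using a_closed[of "f x" "sum f S"] by simp
  qed (use zero_closed in simp_all)
  have "(\<Sum>\<mu>\<in>Poly_Mapping.keys p. Poly_Mapping.single \<mu> (Poly_Mapping.lookup p \<mu>)) \<in> I"
    by (rule sum_mem) (rule mem)
  then show "p \<in> I"
    by (simp flip: poly_eq_sum_single)
qed

text \<open>
  Shows that \<open>\<Sum>j. p_j e_j\<close> lies in \<open>\<mm>M\<close>. The partial sums are given as a function \<open>t\<close>, which avoids
  finite sums in \<open>M\<close> and, with them, a proof that the Matlis dual is an abelian monoid.
\<close>

lemma max_ideal_smult_sum:
  assumes S: "finite S" and t0: "t {} = \<zero>\<^bsub>M\<^esub>"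
    and t: "\<And>j S'. j \<in> S \<Longrightarrow> j \<notin> S' \<Longrightarrow> finite S' \<Longrightarrow> t (insert j S') = t S' \<oplus>\<^bsub>M\<^esub> p j \<odot>\<^bsub>M\<^esub> e j"
    and p: "\<And>j. j \<in> S \<Longrightarrow> p j \<in> max_ideal" and e: "\<And>j. j \<in> S \<Longrightarrow> e j \<in> carrier M"
  shows "t S \<in> max_ideal_smult M"
  unfolding max_ideal_smult_def
proof (clarify)
  fix H
  assume H: "submodule H poly_ring M" and pe: "\<forall>p\<in>max_ideal. \<forall>x\<in>carrier M. p \<odot>\<^bsub>M\<^esub> x \<in> H"
  interpret subgroup H "add_monoid M"
    using H by (simp add: submodule_def)
  have "t S' \<in> H" if "finite S'" "S' \<subseteq> S" for S'
    using that
  proof (induction S' rule: finite_induct)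
    case empty
    then show ?case
      using one_closed by (simp add: t0)
  next
    case (insert j S')
    then show ?case
      using m_closed[of "t S'" "p j \<odot>\<^bsub>M\<^esub> e j"] pe p e by (simp add: t)
  qed
  then show "t S \<in> H"
    using S by blast
qed

lemma irredundant_generator_minimal:
  assumes A: "monomial_matrix A" and fin: "finite (rows A)" "finite (cols A)" and irr: "irredundant A"
  shows "mat_generator_minimal A"
  unfolding mat_generator_minimal_def generator_minimal_def
proof
  let ?F = "mat_source A"
  fix x
  assume "x \<in> hom_kernel ?F (mat_target A) (mat_hom A)"
  then have x: "x \<in> carrier ?F" and "mat_hom A x = \<zero>\<^bsub>mat_target A\<^esub>"
    by (simp_all add: hom_kernel_def)
  then have ker: "(\<lambda>i\<in>rows A. \<Sum>j\<in>cols A. x j \<star> mat_col A j i) = (\<lambda>i\<in>rows A. 0)"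
    by (simp add: mat_hom_apply[OF fin] mat_target_def)
  have rel: "(\<Sum>j\<in>cols A. x j \<star> mat_col A j i) = 0" if "i \<in> rows A" for i
    using fun_cong[OF ker, of i] that by simp
  define t where "t S = (\<lambda>j\<in>cols A. if j \<in> S then x j else 0)" for S
  have "t (cols A) \<in> max_ideal_smult ?F"
  proof (rule max_ideal_smult_sum[OF fin(2)])
    show "x j \<in> max_ideal" if "j \<in> cols A" for j
      using constant_coeff_zero[OF A fin(2) irr rel that] by (rule max_idealI)
    show "coord_vec (cols A) j 1 \<in> carrier ?F" for j
      using fin by (simp add: mat_source_carrier coord_vec_def)
    show "t (insert j S) = t S \<oplus>\<^bsub>?F\<^esub> x j \<odot>\<^bsub>?F\<^esub> coord_vec (cols A) j 1"
      if "j \<in> cols A" "j \<notin> S" for j S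
      using that by (auto simp: t_def mat_source_eq coord_vec_def intro!: restrict_ext)
  qed (simp add: t_def mat_source_eq restrict_def)
  moreover have "t (cols A) = (\<lambda>j\<in>cols A. x j)"
    unfolding t_def by (rule restrict_ext) simp
  then have "t (cols A) = x"
    using x fin by (simp add: mat_source_carrier PiE_restrict)
  ultimately show "x \<in> max_ideal_smult ?F"
    by simp
qed

text \<open>
  A homomorphism to \<open>R^\<or>\<close> is determined by the coefficient of its values in degree \<open>0\<close>, since the
  coefficient in degree \<open>b\<close> is moved there by \<open>X^(-b)\<close>. For homogeneous \<open>h\<close> this functional sees only
  one homogeneous component of the source, which in each summand is at most one-dimensional. So \<open>h\<close> is
  described by one scalar \<open>c_i\<close> per summand, and it agrees with multiplication by \<open>c_i X^(a + \<alpha>_i)\<close>.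
\<close>

lemma matlis_dual_homogeneous_eq:
  fixes \<alpha> :: "'i \<Rightarrow> 'n::finite deg"
    and h :: "('i \<Rightarrow> 'n deg \<Rightarrow>\<^sub>0 'k::field) \<Rightarrow> 'n deg \<Rightarrow>\<^sub>0 'k"
  assumes I: "finite I" and h: "h \<in> graded_hom (shift a (shifted_sum I \<alpha> poly_dual)) poly_dual"
  obtains p where "\<And>x. x \<in> carrier (shifted_sum I \<alpha> poly_dual) \<Longrightarrow> h x = (\<Sum>i\<in>I. p i \<star> x i)"
proof -
  let ?E = "shifted_sum I \<alpha> poly_dual :: ('n, 'k, _) grmod"
  let ?l = "Poly_Mapping.lookup" and ?s = "Poly_Mapping.single"
  \<comment> \<open>The degree \<open>- a - \<alpha>_i\<close> is the one that \<open>h\<close> sends to degree \<open>0\<close>. If it is not \<open>\<le> 0\<close>, then \<open>c i\<close>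
    is a junk value, which \<open>monom_at\<close> discards below.\<close>
  define c where "c i = ?l (h (coord_vec I i (?s (- a - \<alpha> i) 1))) 0" for i
  have hc: "h x \<in> carrier poly_dual" if "x \<in> carrier ?E" for x
    using graded_homD(1)[OF h, of x] that by simp
  have ha: "h (x \<oplus>\<^bsub>?E\<^esub> y) = h x + h y" if "x \<in> carrier ?E" "y \<in> carrier ?E" for x y
    using graded_homD(2)[OF h, of x y] that by simp
  have hs: "h (p \<odot>\<^bsub>?E\<^esub> x) = p \<star> h x" if "x \<in> carrier ?E" for p x
    using graded_homD(3)[OF h, of x p] that by simp
  have single: "?l (h (coord_vec I i (?s d r))) 0 = (if d = - a - \<alpha> i then r * c i else 0)"
    if d: "d \<le> 0" for i d r
  proof (cases "d = - a - \<alpha> i")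
    case True
    have "?s d 1 \<in> carrier poly_dual"
      using d by (simp add: dual_carrier lookup_single when_def)
    then have e: "coord_vec I i (?s d 1) \<in> carrier ?E"
      by (rule dual.coord_vec_carrier[OF I])
    have "?s d r = monom_at 0 r \<star> ?s d 1"
      using d by (simp add: monom_at_dual_act_single)
    then have "coord_vec I i (?s d r) = monom_at 0 r \<odot>\<^bsub>?E\<^esub> coord_vec I i (?s d 1)"
      by (simp only: dual.smult_coord_vec)
    then have "h (coord_vec I i (?s d r)) = monom_at 0 r \<star> h (coord_vec I i (?s d 1))"
      using hs[OF e] by simp
    then show ?thesis
      using True by (simp add: lookup_monom_at_dual_act c_def)
  next
    case False
    have "?s d r \<in> comp poly_dual d"
      using d by (simp add: dual_comp lookup_single when_def)
    then have "coord_vec I i (?s d r) \<in> comp ?E (d + \<alpha> i)"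
      by (rule dual.coord_vec_comp[OF I])
    then have "h (coord_vec I i (?s d r)) \<in> comp poly_dual (d + \<alpha> i + a)"
      using graded_homD(4)[OF h, of "coord_vec I i (?s d r)" "d + \<alpha> i + a"] by simp
    then have "?l (h (coord_vec I i (?s d r))) 0 \<noteq> 0 \<longrightarrow> 0 = d + \<alpha> i + a"
      unfolding dual_comp by blast
    moreover have "0 \<noteq> d + \<alpha> i + a"
    proof
      assume eq: "0 = d + \<alpha> i + a"
      have "d l = (- a - \<alpha> i) l" for l
        using fun_cong[OF eq, of l] by simp
      with False show False
        by blast
    qed
    ultimately show ?thesis
      using False by auto
  qed
  have coord: "?l (h (coord_vec I i v)) 0 = ?l v (- a - \<alpha> i) * c i" if v: "v \<in> carrier poly_dual" for i v
  proof -
    have s: "?s d (?l v d) \<in> carrier poly_dual" for d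
      using v by (simp add: dual_carrier lookup_single when_def)
    have ca: "coord_vec I i (u + w) = coord_vec I i u \<oplus>\<^bsub>?E\<^esub> coord_vec I i w"
      for u w :: "'n deg \<Rightarrow>\<^sub>0 'k"
      by (auto simp: coord_vec_def intro!: restrict_ext)
    have "h (coord_vec I i (\<Sum>d\<in>D. ?s d (?l v d))) = (\<Sum>d\<in>D. h (coord_vec I i (?s d (?l v d))))"
      if "finite D" for D
      using that
    proof (induction D rule: finite_induct)
      case empty
      have "coord_vec I i (0 :: 'n deg \<Rightarrow>\<^sub>0 'k) \<in> carrier ?E"
        by (rule dual.coord_vec_carrier[OF I]) simp
      from ha[OF this this] ca[of 0 0] show ?case
        by simp
    next
      case (insert d D)
      have step: "h (coord_vec I i (?s d (?l v d)) \<oplus>\<^bsub>?E\<^esub> coord_vec I i (\<Sum>d\<in>D. ?s d (?l v d))) =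
          h (coord_vec I i (?s d (?l v d))) + h (coord_vec I i (\<Sum>d\<in>D. ?s d (?l v d)))"
        by (intro ha dual.coord_vec_carrier I s dual.sum_mem)
      show ?case
        by (simp only: sum.insert[OF insert(1,2)] ca step insert(3))
    qed
    from this[OF finite_keys, of v] have "?l (h (coord_vec I i v)) 0 =
        (\<Sum>d\<in>Poly_Mapping.keys v. ?l (h (coord_vec I i (?s d (?l v d)))) 0)"
      by (simp add: lookup_sum flip: poly_eq_sum_single)
    also have "\<dots> = (\<Sum>d\<in>Poly_Mapping.keys v. if d = - a - \<alpha> i then ?l v (- a - \<alpha> i) * c i else 0)"
      using v by (intro sum.cong refl) (auto simp: dual_carrier in_keys_iff single)
    also have "\<dots> = ?l v (- a - \<alpha> i) * c i"
      by (simp add: in_keys_iff)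
    finally show ?thesis .
  qed
  have zero: "?l (h x) 0 = (\<Sum>i\<in>I. ?l (x i) (- a - \<alpha> i) * c i)" if x: "x \<in> carrier ?E" for x
  proof -
    have "x i \<in> carrier poly_dual" if "i \<in> I" for i
      using x I that by auto
    moreover have "h x = (\<Sum>i\<in>I. h (coord_vec I i (x i)))"
      by (rule dual.additive_eq_sum_coord_vec[OF I x ha])
    ultimately show ?thesis
      by (simp add: lookup_sum coord)
  qed
  define p where "p i = monom_at (a + \<alpha> i) (c i)" for i
  have nonpos_iff: "- a - \<alpha> i \<le> 0 \<longleftrightarrow> 0 \<le> a + \<alpha> i" for i
  proof -
    have "(- a - \<alpha> i) l \<le> 0 \<longleftrightarrow> 0 \<le> (a + \<alpha> i) l" for l
      by auto
    then show ?thesis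
      by (simp only: le_fun_def zero_fun_apply)
  qed
  have "h x = (\<Sum>i\<in>I. p i \<star> x i)" if x: "x \<in> carrier ?E" for x
  proof (rule poly_mapping_eqI)
    fix b
    show "?l (h x) b = ?l (\<Sum>i\<in>I. p i \<star> x i) b"
    proof (cases "b \<le> 0")
      case True
      let ?m = "monom_at (- b) (1 :: 'k)"
      have mx: "?m \<odot>\<^bsub>?E\<^esub> x \<in> carrier ?E"
        using I by (simp add: dual_act_in_carrier)
      have "?l (h x) b = ?l (?m \<star> h x) 0"
        using True by (simp add: lookup_monom_at_dual_act)
      also have "\<dots> = (\<Sum>i\<in>I. ?l (?m \<star> x i) (- a - \<alpha> i) * c i)"
        using zero[OF mx] hs[OF x, of ?m] by simp
      also have "\<dots> = (\<Sum>i\<in>I. ?l (p i \<star> x i) b)"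
      proof (rule sum.cong[OF refl])
        fix i
        show "?l (?m \<star> x i) (- a - \<alpha> i) * c i = ?l (p i \<star> x i) b"
        proof (cases "0 \<le> a + \<alpha> i")
          case nonneg: True
          then have le: "- a - \<alpha> i \<le> 0"
            by (simp only: nonpos_iff)
          have idx: "- a - \<alpha> i - - b = b - (a + \<alpha> i)"
            by simp
          have "?l (?m \<star> x i) (- a - \<alpha> i) =
              (if - a - \<alpha> i \<le> 0 then 1 * ?l (x i) (- a - \<alpha> i - - b) else 0)"
            using True by (intro lookup_monom_at_dual_act) simp
          then have "?l (?m \<star> x i) (- a - \<alpha> i) = ?l (x i) (b - (a + \<alpha> i))"
            by (simp only: le idx if_True mult_1_left)
          then show ?thesis
            using True nonneg by (simp add: p_def lookup_monom_at_dual_act mult.commute)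
        next
          case neg: False
          then have "\<not> - a - \<alpha> i \<le> 0"
            by (simp only: nonpos_iff simp_thms)
          with neg show ?thesis
            by (simp add: p_def dual_act_not_nonpos monom_at_def)
        qed
      qed
      finally show ?thesis
        by (simp add: lookup_sum)
    next
      case False
      then show ?thesis
        using hc[OF x] by (auto simp: lookup_sum dual_act_not_nonpos dual_carrier)
    qed
  qed
  then show thesis
    by (rule that)
qed

lemma matlis_dual_eq:
  assumes I: "finite I" and f: "f \<in> carrier (matlis_dual (shifted_sum I \<alpha> poly_dual))"
  obtains p where "\<And>x. x \<in> carrier (shifted_sum I \<alpha> poly_dual) \<Longrightarrow> f x = (\<Sum>i\<in>I. p i \<star> x i)"
proof -
  let ?E = "shifted_sum I \<alpha> poly_dual"
  obtain D h where D: "finite D" "\<forall>a\<in>D. h a \<in> graded_hom (shift a ?E) poly_dual"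
    and feq: "f = (\<lambda>x\<in>carrier ?E. \<Sum>a\<in>D. h a x)"
    using f unfolding matlis_dual_carrier by blast
  have "\<forall>a\<in>D. \<exists>p. \<forall>x\<in>carrier ?E. h a x = (\<Sum>i\<in>I. p i \<star> x i)"
  proof
    fix a
    assume "a \<in> D"
    then have "h a \<in> graded_hom (shift a ?E) poly_dual"
      using D(2) by blast
    then show "\<exists>p. \<forall>x\<in>carrier ?E. h a x = (\<Sum>i\<in>I. p i \<star> x i)"
    proof (rule matlis_dual_homogeneous_eq[OF I])
      fix p
      assume "\<And>x. x \<in> carrier ?E \<Longrightarrow> h a x = (\<Sum>i\<in>I. p i \<star> x i)"
      then show ?thesis
        by (intro exI ballI)
    qed
  qed
  from bchoice[OF this] obtain p
    where p: "\<forall>a\<in>D. \<forall>x\<in>carrier ?E. h a x = (\<Sum>i\<in>I. p a i \<star> x i)" ..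
  have "f x = (\<Sum>i\<in>I. (\<Sum>a\<in>D. p a i) \<star> x i)" if x: "x \<in> carrier ?E" for x
  proof -
    have "f x = (\<Sum>a\<in>D. h a x)"
      unfolding feq by (rule restrict_apply'[OF x])
    also have "\<dots> = (\<Sum>a\<in>D. \<Sum>i\<in>I. p a i \<star> x i)"
      using p x by (intro sum.cong refl) blast
    also have "\<dots> = (\<Sum>i\<in>I. (\<Sum>a\<in>D. p a i) \<star> x i)"
      unfolding dual_act_sum_left by (rule sum.swap)
    finally show ?thesis .
  qed
  then show thesis
    by (rule that)
qed

text \<open>
  Let \<open>f = (u \<mapsto> \<Sum>i. p_i u_i)\<close> be in the kernel of the dual homomorphism. Evaluating \<open>f\<close> on the images
  of the basis elements shows that the \<open>p_i\<close> satisfy the relations of the transposed matrix, so they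
  have no constant term. As \<open>f = \<Sum>i. p_i \<pi>_i\<close> with the coordinate projections \<open>\<pi>_i\<close>, it lies in
  \<open>\<mm>E^\<or>\<close>.
\<close>

lemma irredundant_transpose_cogenerator_minimal:
  assumes A: "monomial_matrix A" and fin: "finite (rows A)" "finite (cols A)"
    and irr: "irredundant (mat_transpose A)"
  shows "mat_cogenerator_minimal A"
  unfolding mat_cogenerator_minimal_def cogenerator_minimal_def generator_minimal_def
proof
  let ?F = "mat_source A" and ?E = "mat_target A"
  fix f
  assume "f \<in> hom_kernel (matlis_dual ?E) (matlis_dual ?F) (matlis_dual_hom ?F ?E (mat_hom A))"
  then have f: "f \<in> carrier (matlis_dual ?E)"
    and "matlis_dual_hom ?F ?E (mat_hom A) f = \<zero>\<^bsub>matlis_dual ?F\<^esub>"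
    by (simp_all add: hom_kernel_def)
  then have ker: "compose (carrier ?F) f (mat_hom A) = (\<lambda>x\<in>carrier ?F. 0)"
    by (simp add: matlis_dual_hom_def)
  obtain p where p: "\<And>x. x \<in> carrier ?E \<Longrightarrow> f x = (\<Sum>i\<in>rows A. p i \<star> x i)"
    using matlis_dual_eq[OF fin(1), of f "cogdeg A"] f unfolding mat_target_def by blast
  have "(\<Sum>i\<in>rows A. p i \<star> mat_col A j i) = 0" if j: "j \<in> cols A" for j
  proof -
    let ?e = "coord_vec (cols A) j 1"
    have e: "?e \<in> carrier ?F"
      using fin by (simp add: mat_source_carrier coord_vec_def)
    have e_col: "mat_hom A ?e i = mat_col A j i" if i: "i \<in> rows A" for i
    proof -
      have "mat_hom A ?e i = (\<Sum>l\<in>cols A. if l = j then 1 \<star> mat_col A j i else 0)"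
        unfolding mat_hom_apply[OF fin e] restrict_apply'[OF i]
        by (intro sum.cong refl) (simp add: coord_vec_def)
      also have "\<dots> = mat_col A j i"
        using fin j dual.comp_subset[OF mat_col_comp[OF i]] by (simp add: dual_act_one)
      finally show ?thesis .
    qed
    have "mat_hom A ?e \<in> carrier ?E"
      using graded_homD(1)[OF mat_hom_graded_hom[OF fin] e] .
    then have "f (mat_hom A ?e) = (\<Sum>i\<in>rows A. p i \<star> mat_hom A ?e i)"
      by (rule p)
    moreover have "f (mat_hom A ?e) = 0"
      using fun_cong[OF ker, of ?e] e by (simp add: compose_def)
    ultimately show ?thesis
      by (simp add: e_col)
  qed
  then have rel: "(\<Sum>i\<in>cols (mat_transpose A). p i \<star> mat_col (mat_transpose A) i j) = 0"
    if "j \<in> rows (mat_transpose A)" for j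
    using that by (simp add: mat_col_transpose)
  have p0: "pcoeff (p i) 0 = 0" if "i \<in> rows A" for i
    using constant_coeff_zero[of "mat_transpose A" p i] A fin irr rel that
    by (simp add: monomial_matrix_transpose)
  define t where "t S = (\<lambda>x\<in>carrier ?E. \<Sum>i\<in>S. p i \<star> x i)" for S
  have Ecl: "graded_closed ?E"
    by (rule graded_closed_mat_target[OF fin(1)])
  have "t (rows A) \<in> max_ideal_smult (matlis_dual ?E)"
  proof (rule max_ideal_smult_sum[OF fin(1)])
    show "p i \<in> max_ideal" if "i \<in> rows A" for i
      using p0[OF that] by (rule max_idealI)
    show "(\<lambda>x\<in>carrier ?E. x i) \<in> carrier (matlis_dual ?E)" if i: "i \<in> rows A" for i
    proof -
      have "(\<lambda>x\<in>carrier (shift (- cogdeg A i) ?E). x i) \<in> graded_hom (shift (- cogdeg A i) ?E) poly_dual"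
      proof (rule graded_hom_restrictI[OF graded_closed_shift[OF Ecl]])
        fix a x
        assume "x \<in> comp (shift (- cogdeg A i) ?E) a"
        then show "x i \<in> comp poly_dual a"
          using PiE_mem[of x "rows A" "\<lambda>l. comp poly_dual (a + cogdeg A i - cogdeg A l)" i] i fin
          by (simp add: mat_target_def)
      qed (use i fin in \<open>auto simp: mat_target_def\<close>)
      then show ?thesis
        using comp_subset_matlis_dual by auto
    qed
    show "t (insert i S) = t S \<oplus>\<^bsub>matlis_dual ?E\<^esub> p i \<odot>\<^bsub>matlis_dual ?E\<^esub> (\<lambda>x\<in>carrier ?E. x i)"
      if "i \<notin> S" "finite S" for i S
      using that by (simp add: t_def add.commute cong: restrict_cong)
  qed (simp add: t_def restrict_def)
  moreover have "t (rows A) = f"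
  proof
    fix x
    show "t (rows A) x = f x"
      using p[of x] matlis_dual_carrierD(4)[OF f Ecl, of x] by (cases "x \<in> carrier ?E") (simp_all add: t_def)
  qed
  ultimately show "f \<in> max_ideal_smult (matlis_dual ?E)"
    by simp
qed

section \<open>Correctness of the reduction\<close>

theorem mainTheorem4:
  fixes A :: "('i, 'j, 'n::finite, 'k::field) monmat"
    and M :: "('n, 'k, 'm) grmod"
    and js :: "'j list" and rs :: "'i list"
  assumes "monomial_matrix A" and "finite (rows A)" and "finite (cols A)"
    and "represents_presentation A M"
    and "distinct js" and "set js = cols A"
    and "distinct rs" and "set rs = rows A"
  shows "let A1 = rg js A;
             A' = mat_transpose (rg rs (mat_transpose A1))
         in monomial_matrix A' \<and> represents_presentation A' M \<and>
            mat_generator_minimal A' \<and> mat_cogenerator_minimal A'"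
proof -
  define A1 where "A1 = rg js A"
  define A' where "A' = mat_transpose (rg rs (mat_transpose A1))"
  have M: "graded_module M"
    using assms(4) by (simp add: represents_presentation_def free_cofree_presentation_def)
  then have Mcl: "graded_closed M"
    by (rule graded_module_closed)
  define good where "good B \<longleftrightarrow> monomial_matrix B \<and> finite (rows B) \<and> finite (cols B) \<and>
    graded_isomorphic (mat_image B) M" for B :: "('i, 'j, 'n, 'k) monmat"
  \<comment> \<open>The invariant of the first pass includes the rows, since the second pass goes through those of \<open>A\<close>.\<close>
  have "good A \<and> rows A = rows A"
    using assms(1-4) by (simp add: good_def represents_presentation_def free_cofree_presentation_def)
  then have A1: "good A1 \<and> rows A1 = rows A"
    unfolding A1_def
  proof (rule rg_invariant[where P = "\<lambda>B. good B \<and> rows B = rows A"])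
    fix B :: "('i, 'j, 'n, 'k) monmat" and j
    assume B: "good B \<and> rows B = rows A" and j: "j \<in> cols B" "redundant B j"
    have "mat_image (B\<lparr>cols := cols B - {j}\<rparr>) = mat_image B"
    proof (rule mat_image_remove_col)
      show "finite (rows B)" "finite (cols B)" "monomial_matrix B"
        using B unfolding good_def by blast+
    qed (fact j)+
    with B show "good (B\<lparr>cols := cols B - {j}\<rparr>) \<and> rows (B\<lparr>cols := cols B - {j}\<rparr>) = rows A"
      using assms(2) by (simp add: good_def monomial_matrix_def)
  qed
  have irr1: "irredundant A1"
    unfolding A1_def using assms(3,6) by (intro rg_irredundant) simp_all
  define good_irredundant where "good_irredundant C \<longleftrightarrow> good (mat_transpose C) \<and> irredundant (mat_transpose C)"
    for C :: "('j, 'i, 'n, 'k) monmat"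
  have "good_irredundant (mat_transpose A1)"
    using A1 irr1 by (simp add: good_irredundant_def mat_transpose_transpose)
  then have "good_irredundant (rg rs (mat_transpose A1))"
  proof (rule rg_invariant)
    fix C :: "('j, 'i, 'n, 'k) monmat" and i
    assume C: "good_irredundant C" and i: "i \<in> cols C" "redundant C i"
    define B where "B = mat_transpose C"
    let ?B' = "B\<lparr>rows := rows B - {i}\<rparr>"
    have BC: "mat_transpose B = C"
      by (simp add: B_def mat_transpose_transpose)
    have B': "mat_transpose (C\<lparr>cols := cols C - {i}\<rparr>) = ?B'"
      by (simp add: B_def mat_transpose_def)
    have B: "monomial_matrix B" "finite (rows B)" "finite (cols B)" "graded_isomorphic (mat_image B) M"
        "irredundant B"
      using C by (simp_all add: good_irredundant_def good_def B_def)
    have i': "i \<in> rows B" "redundant (mat_transpose B) i"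
      using i by (simp_all add: BC, simp add: B_def)
    have fin': "finite (rows ?B')" "finite (cols ?B')"
      using B by simp_all
    have "graded_isomorphic (mat_image ?B') (mat_image B)"
      using B i' by (intro mat_image_remove_row)
    moreover have "graded_closed (mat_image ?B')"
      by (rule graded_closed_image[OF mat_hom_graded_hom[OF fin'] graded_closed_mat_source[OF fin'(2)]])
    ultimately have "graded_isomorphic (mat_image ?B') M"
      using graded_isomorphic_trans B(4) Mcl by blast
    moreover have "irredundant ?B'"
      using redundant_if_fewer_rows[OF B(1) _ i'] B(5) by (auto simp: irredundant_def)
    moreover have "monomial_matrix ?B'"
      using B(1) by (simp add: monomial_matrix_def)
    ultimately show "good_irredundant (C\<lparr>cols := cols C - {i}\<rparr>)"
      using fin' unfolding good_irredundant_def B' good_def by blast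
  qed
  then have A': "monomial_matrix A'" "finite (rows A')" "finite (cols A')"
      "graded_isomorphic (mat_image A') M" "irredundant A'"
    by (simp_all add: good_irredundant_def good_def A'_def)
  have "irredundant (rg rs (mat_transpose A1))"
    using A1 assms(2,8) by (intro rg_irredundant) simp_all
  then have "irredundant (mat_transpose A')"
    by (simp add: A'_def mat_transpose_transpose)
  then have "monomial_matrix A' \<and> represents_presentation A' M \<and>
      mat_generator_minimal A' \<and> mat_cogenerator_minimal A'"
    using A' M by (intro conjI represents_presentationI irredundant_generator_minimal
        irredundant_transpose_cogenerator_minimal)
  then show ?thesis
    by (simp add: A'_def A1_def Let_def)
qed

end
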